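(* The OB unboundedness and OB termination problems are decidable for FIFO machines. That is, given a FIFO machine $M=(Q,\mathit{Ch},\Sigma,\Delta,q_0)$ and a tuple $(L_c)_{c\in\mathit{Ch}}$ of non-empty regular bounded languages $L_c\subseteq\Sigma_c^\ast$, it is decidable (i) whether $\mathrm{Reach}_M(\mathrm{Pref}(L_?))$ is infinite, and (ii) whether there is no infinite execution $s_0\xrightarrow{\beta_1}s_1\xrightarrow{\beta_2}s_2\cdots$ from the initial configuration $s_0$ with $\beta_i\in A_M$ and $\beta_1\cdots\beta_i\in\mathrm{Pref}(L_?)$ for all $i$.
   Context: A bounded language over non-empty words $(w_1,\ldots,w_n)$ is a language $L\subseteq w_1^\ast\cdots w_n^\ast$. A FIFO machine is $M=(Q,\mathit{Ch},\Sigma,\Delta,q_0)$ with finite control states $Q$, initial state $q_0$, finite channels $\mathit{Ch}$, alphabet $\Sigma=\biguplus_c\Sigma_c$, and $\Delta\subseteq Q\times A_M\times Q$, $A_M=\{c!a,c?a\mid c\in\mathit{Ch},a\in\Sigma_c\}$. Configurations $(q,\mathbf{w})$ with $\mathbf{w}\in\prod_c\Sigma_c^\ast$; initial $(q_0,(\varepsilon)_c)$. A send $c!a$ appends $a$ to channel $c$; a receive $c?a$ removes $a$ from the head of channel $c$ (only possible if $a$ is at the head); other channels unchanged; the control state moves along a transition of $\Delta$. $\mathrm{Reach}_M(L)$ is the set of configurations reachable from the initial one via a label word in $L\subseteq A_M^\ast$. $L_?=\{\sigma\in A_M^\ast\mid\mathrm{proj}_{c?}(\sigma)\in L_c\ \forall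 c\}$, where $\mathrm{proj}_{c?}$ keeps the messages of receive actions on $c$ and erases all other actions. $\mathrm{Pref}(L)$ is the set of prefixes of words in $L$. *)

theory Defs
  imports Main "HOL-Library.Nat_Bijection"
begin

datatype recf = RZero | RSucc | RProj nat | RComp recf "recf list"
  | RPrim recf recf | RMin recf

inductive eval_recf :: "recf \<Rightarrow> nat list \<Rightarrow> nat \<Rightarrow> bool" where
  ev_zero: "eval_recf RZero xs 0"
| ev_succ: "eval_recf RSucc (x # xs) (Suc x)"
| ev_proj: "i < length xs \<Longrightarrow> eval_recf (RProj i) xs (xs ! i)"
| ev_comp: "length ys = length gs \<Longrightarrow> (\<forall>i<length gs. eval_recf (gs ! i) xs (ys ! i))
     \<Longrightarrow> eval_recf f ys z \<Longrightarrow> eval_recf (RComp f gs) xs z"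
| ev_prim0: "eval_recf f xs y \<Longrightarrow> eval_recf (RPrim f g) (0 # xs) y"
| ev_primS: "eval_recf (RPrim f g) (n # xs) y \<Longrightarrow> eval_recf g (y # n # xs) z
     \<Longrightarrow> eval_recf (RPrim f g) (Suc n # xs) z"
| ev_min: "eval_recf f (n # xs) 0 \<Longrightarrow> (\<forall>m<n. \<exists>y. eval_recf f (m # xs) (Suc y))
     \<Longrightarrow> eval_recf (RMin f) xs n"

definition decidable_on :: "('a \<Rightarrow> nat) \<Rightarrow> ('a \<Rightarrow> bool) \<Rightarrow> ('a \<Rightarrow> bool) \<Rightarrow> bool" where
  "decidable_on enc valid P \<longleftrightarrow>
     (\<exists>f. \<forall>x. valid x \<longrightarrow> eval_recf f [enc x] (if P x then 1 else 0))"

text \<open>Channels are 0..<nch; letters are nats; an action names channel and letter.\<close>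
datatype act = Send nat nat | Recv nat nat

datatype fifo = FIFO (states: "nat list") (nch: nat) (sigma: "nat list list")
  (delta: "(nat \<times> act \<times> nat) list") (q0: nat)

definition actions :: "fifo \<Rightarrow> act set" where
  "actions M = {Send c a | c a. c < nch M \<and> a \<in> set (sigma M ! c)}
             \<union> {Recv c a | c a. c < nch M \<and> a \<in> set (sigma M ! c)}"

definition wf_fifo :: "fifo \<Rightarrow> bool" where
  "wf_fifo M \<longleftrightarrow> q0 M \<in> set (states M) \<and> length (sigma M) = nch M
     \<and> (\<forall>c<nch M. \<forall>d<nch M. c \<noteq> d \<longrightarrow> set (sigma M ! c) \<inter> set (sigma M ! d) = {})
     \<and> (\<forall>(q,a,q')\<in>set (delta M). q \<in> set (states M) \<and> q' \<in> set (states M) \<and> a \<in> actions M)"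

type_synonym config = "nat \<times> nat list list"

definition init_config :: "fifo \<Rightarrow> config" where
  "init_config M = (q0 M, replicate (nch M) [])"

fun step :: "fifo \<Rightarrow> config \<Rightarrow> act \<Rightarrow> config \<Rightarrow> bool" where
  "step M (q, w) (Send c a) (q', w') \<longleftrightarrow> (q, Send c a, q') \<in> set (delta M) \<and> c < nch M
      \<and> w' = w[c := w ! c @ [a]]"
| "step M (q, w) (Recv c a) (q', w') \<longleftrightarrow> (q, Recv c a, q') \<in> set (delta M) \<and> c < nch M
      \<and> w ! c \<noteq> [] \<and> hd (w ! c) = a \<and> w' = w[c := tl (w ! c)]"

inductive steps :: "fifo \<Rightarrow> config \<Rightarrow> act list \<Rightarrow> config \<Rightarrow> bool" for M where
  steps_nil: "steps M s [] s"
| steps_cons: "step M s a s' \<Longrightarrow> steps M s' \<sigma> s'' \<Longrightarrow> steps M s (a # \<sigma>) s''"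

definition Reach :: "fifo \<Rightarrow> act list set \<Rightarrow> config set" where
  "Reach M L = {s. \<exists>\<sigma>\<in>L. steps M (init_config M) \<sigma> s}"

datatype nfa = NFA (n_init: "nat list") (n_final: "nat list") (n_trans: "(nat \<times> nat \<times> nat) list")

fun runs_nfa :: "nfa \<Rightarrow> nat \<Rightarrow> nat list \<Rightarrow> nat \<Rightarrow> bool" where
  "runs_nfa A p [] q \<longleftrightarrow> p = q"
| "runs_nfa A p (x # xs) q \<longleftrightarrow> (\<exists>p'. (p, x, p') \<in> set (n_trans A) \<and> runs_nfa A p' xs q)"

definition lang :: "nfa \<Rightarrow> nat list set" where
  "lang A = {w. \<exists>p\<in>set (n_init A). \<exists>q\<in>set (n_final A). runs_nfa A p w q}"

definition bounded_expr :: "'a list list \<Rightarrow> 'a list set" where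
  "bounded_expr ws = {concat us | us. length us = length ws
       \<and> (\<forall>i<length ws. \<exists>k. us ! i = concat (replicate k (ws ! i)))}"

definition bounded_lang :: "'a list set \<Rightarrow> bool" where
  "bounded_lang L \<longleftrightarrow> (\<exists>ws. (\<forall>w\<in>set ws. w \<noteq> []) \<and> L \<subseteq> bounded_expr ws)"

definition Pref :: "'a list set \<Rightarrow> 'a list set" where
  "Pref L = {u. \<exists>v. u @ v \<in> L}"

definition proj_recv :: "nat \<Rightarrow> act list \<Rightarrow> nat list" where
  "proj_recv c \<sigma> = concat (map (\<lambda>b. case b of Recv d a \<Rightarrow> if d = c then [a] else [] | Send _ _ \<Rightarrow> []) \<sigma>)"

definition Lq :: "fifo \<Rightarrow> nat list set list \<Rightarrow> act list set" where
  "Lq M Ls = {\<sigma>. set \<sigma> \<subseteq> actions M \<and> (\<forall>c<nch M. proj_recv c \<sigma> \<in> Ls ! c)}"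

definition valid_instance :: "fifo \<times> nfa list \<Rightarrow> bool" where
  "valid_instance I \<longleftrightarrow> (case I of (M, As) \<Rightarrow> wf_fifo M \<and> length As = nch M
     \<and> (\<forall>c<nch M. lang (As ! c) \<noteq> {} \<and> bounded_lang (lang (As ! c))
                   \<and> lang (As ! c) \<subseteq> lists (set (sigma M ! c))))"

definition OB_unbounded :: "fifo \<times> nfa list \<Rightarrow> bool" where
  "OB_unbounded I \<longleftrightarrow> (case I of (M, As) \<Rightarrow>
     infinite (Reach M (Pref (Lq M (map lang As)))))"

definition OB_terminating :: "fifo \<times> nfa list \<Rightarrow> bool" where
  "OB_terminating I \<longleftrightarrow> (case I of (M, As) \<Rightarrow>
     \<not> (\<exists>s \<beta>. s 0 = init_config M \<and> (\<forall>i. step M (s i) (\<beta> i) (s (Suc i)))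
            \<and> (\<forall>i. map \<beta> [0..<Suc i] \<in> Pref (Lq M (map lang As)))))"

fun enc_act :: "act \<Rightarrow> nat" where
  "enc_act (Send c a) = prod_encode (0, prod_encode (c, a))"
| "enc_act (Recv c a) = prod_encode (1, prod_encode (c, a))"

fun enc_trans :: "nat \<times> act \<times> nat \<Rightarrow> nat" where
  "enc_trans (q, a, q') = list_encode [q, enc_act a, q']"

definition enc_fifo :: "fifo \<Rightarrow> nat" where
  "enc_fifo M = list_encode [list_encode (states M), nch M,
     list_encode (map list_encode (sigma M)), list_encode (map enc_trans (delta M)), q0 M]"

definition enc_nfa :: "nfa \<Rightarrow> nat" where
  "enc_nfa A = list_encode [list_encode (n_init A), list_encode (n_final A),
     list_encode (map (\<lambda>(p, x, q). list_encode [p, x, q]) (n_trans A))]"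

definition enc_instance :: "fifo \<times> nfa list \<Rightarrow> nat" where
  "enc_instance I = (case I of (M, As) \<Rightarrow> prod_encode (enc_fifo M, list_encode (map enc_nfa As)))"

end

(*
The received words determine a deterministic product of the machine with the automata of the L_c: a
product state consists of a control state, the channel contents and, for each channel, the set of
automaton states reached by the word received so far. Call a pair of positions i < j of a run a pump
if the two product states agree except that every channel content w has become w @ t, where t commutes
with the word sent on that channel in between. A pump can be iterated: after k rounds the contents are
w @ t^k. Conversely every infinite run has a pump. On a channel with finitely many receives this is
clear; otherwise the infinite received word is also the sent word, it is eventually periodic because
L_c is bounded, and positions that agree modulo the period with non-decreasing content length do the
job; a subsequence argument treats all channels and finite components at once. By Koenig's lemma there
is an n such that every run of length n has a pump, and n is found by unbounded search. The machine
terminates iff it has no run of length n, and its reachability set is infinite iff some run of length n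
has a pump with two distinct product states.
*)
theory Submission
  imports Defs "HOL-Library.Sublist" "HOL-Library.Infinite_Set"
begin

section \<open>Computable functions between encoded types\<close>

text \<open>The words that bound \<open>L_c\<close> are never computed: the procedure sees only the
  automata, and boundedness serves to show that the search for \<open>n\<close> ends. No explicit
  bound on \<open>n\<close> is derived. Longer contents alone do not make a loop repeatable, since a
  queue is read from the head and the repeated loop meets letters in an order fixed by earlier
  sends. Commutation of the added word \<open>t\<close> with the sent word lets the surplus
  \<open>t\<close> stay at the tail during a replay. In an eventually periodic word it holds because
  both words can be read from the same position and have lengths divisible by the period. Membership
  in \<open>Pref\<close> of \<open>L_?\<close> speaks about whole words. It reduces to a test on
  each receive because every channel can be completed separately, by receive actions that need not
  be executable. If the ends of a pump differ, some content becomes strictly longer, so iteration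
  yields infinitely many configurations. Conversely, a shortest run to a product state repeats no
  product state; if it is longer than \<open>n\<close>, the pump in its prefix of length
  \<open>n\<close> therefore has distinct ends.\<close>

text \<open>The encoders are explicit parameters and need not be injective, so that the encoders of the
  problem instances can be used as they are.\<close>

definition computable :: "('a \<Rightarrow> nat) \<Rightarrow> ('b \<Rightarrow> nat) \<Rightarrow> ('a \<Rightarrow> 'b) \<Rightarrow> bool" where
  "computable e d f \<longleftrightarrow> (\<exists>F. \<forall>x. eval_recf F [e x] (d (f x)))"

text \<open>Two separate arguments are needed until the pairing function, itself built from addition
  and \<open>triangle\<close>, is known to be recursive.\<close>

definition computable2 :: "(nat \<Rightarrow> nat \<Rightarrow> nat) \<Rightarrow> bool" where
  "computable2 h \<longleftrightarrow> (\<exists>F. \<forall>a b. eval_recf F [a, b] (h a b))"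

named_theorems computable_intros

abbreviation nat_enc :: "nat \<Rightarrow> nat" where "nat_enc \<equiv> id"

definition bool_enc :: "bool \<Rightarrow> nat" where "bool_enc b = (if b then 1 else 0)"

definition prod_enc :: "('a \<Rightarrow> nat) \<Rightarrow> ('b \<Rightarrow> nat) \<Rightarrow> 'a \<times> 'b \<Rightarrow> nat" where
  "prod_enc e d p = prod_encode (e (fst p), d (snd p))"

definition list_enc :: "('a \<Rightarrow> nat) \<Rightarrow> 'a list \<Rightarrow> nat" where
  "list_enc e xs = list_encode (map e xs)"

section \<open>Composition, primitive recursion and elementary arithmetic\<close>

lemma ev_proj0: "eval_recf (RProj 0) (x # xs) x"
  using ev_proj[of 0 "x # xs"] by simp

lemma ev_proj1: "eval_recf (RProj 1) (x # y # xs) y"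
  using ev_proj[of 1 "x # y # xs"] by simp

lemma ev_proj2: "eval_recf (RProj 2) (x # y # z # xs) z"
  using ev_proj[of 2 "x # y # z # xs"] by simp

lemma ev_comp1: "eval_recf g xs y \<Longrightarrow> eval_recf f [y] z \<Longrightarrow> eval_recf (RComp f [g]) xs z"
  by (rule ev_comp[of "[y]"]) auto

lemma ev_comp2:
  "eval_recf g xs y \<Longrightarrow> eval_recf h xs y' \<Longrightarrow> eval_recf f [y, y'] z \<Longrightarrow> eval_recf (RComp f [g, h]) xs z"
  by (rule ev_comp[of "[y, y']"]) (auto simp: less_Suc_eq)

lemma ev_prim_rec:
  assumes "eval_recf f xs z" and "\<And>n y. eval_recf g (y # n # xs) (h n y)"
  shows "eval_recf (RPrim f g) (n # xs) (rec_nat z h n)"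
proof (induction n)
  case 0
  show ?case using ev_prim0[OF assms(1)] by simp
next
  case (Suc n)
  show ?case using ev_primS[OF Suc assms(2)] by simp
qed

lemma computable_id [computable_intros]: "computable e e (\<lambda>x. x)"
  unfolding computable_def using ev_proj0 by metis

text \<open>Computability depends on codes alone, so a function on numbers can be exchanged for one
  between other types that produces the same codes. This replaces any explicit decoding.\<close>

lemma computable_cong_code: "computable e d f \<Longrightarrow> (\<And>x. d' (g x) = d (f x)) \<Longrightarrow> computable e d' g"
  unfolding computable_def by auto

lemma computable_code: "computable e d f \<Longrightarrow> computable e nat_enc (\<lambda>x. d (f x))"
  unfolding computable_def by auto

lemma computable_of_code: "computable e nat_enc (\<lambda>x. d (f x)) \<Longrightarrow> computable e d f"
  unfolding computable_def by auto

lemma computable_comp: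
  assumes "computable d c g" "computable e d f"
  shows "computable e c (\<lambda>x. g (f x))"
proof -
  obtain F G where "\<And>x. eval_recf F [e x] (d (f x))" "\<And>y. eval_recf G [d y] (c (g y))"
    using assms unfolding computable_def by blast
  from ev_comp1[OF this] show ?thesis unfolding computable_def by blast
qed

lemma computable_const [computable_intros]: "computable e d (\<lambda>x. c)"
proof -
  have "\<exists>F. \<forall>x. eval_recf F [x] n" for n
  proof (induction n)
    case 0
    then show ?case using ev_zero by metis
  next
    case (Suc n)
    then show ?case using ev_comp1[OF _ ev_succ] by metis
  qed
  then show ?thesis unfolding computable_def by blast
qed

lemma computable_Suc [computable_intros]:
  "computable e nat_enc f \<Longrightarrow> computable e nat_enc (\<lambda>x. Suc (f x))"
  unfolding computable_def using ev_comp1[OF _ ev_succ] by (metis id_apply)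

lemma computable_binary:
  assumes "computable2 h" "computable e nat_enc f" "computable e nat_enc g"
  shows "computable e nat_enc (\<lambda>x. h (f x) (g x))"
proof -
  obtain F G H where "\<And>x. eval_recf F [e x] (f x)" "\<And>x. eval_recf G [e x] (g x)"
    "\<And>a b. eval_recf H [a, b] (h a b)"
    using assms unfolding computable_def computable2_def id_apply by blast
  from ev_comp2[OF this] show ?thesis unfolding computable_def id_apply by blast
qed

lemma computable2_comp:
  assumes "computable nat_enc nat_enc f" "computable2 h"
  shows "computable2 (\<lambda>a b. f (h a b))"
proof -
  obtain F H where "\<And>a b. eval_recf H [a, b] (h a b)" "\<And>x. eval_recf F [x] (f x)"
    using assms unfolding computable_def computable2_def id_apply by blast
  from ev_comp1[OF this] show ?thesis unfolding computable2_def by blast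
qed

lemma computable2_comp2:
  assumes "computable2 f" "computable2 g" "computable2 h"
  shows "computable2 (\<lambda>a b. f (g a b) (h a b))"
proof -
  obtain F G H where "\<And>a b. eval_recf G [a, b] (g a b)" "\<And>a b. eval_recf H [a, b] (h a b)"
    "\<And>a b. eval_recf F [a, b] (f a b)"
    using assms unfolding computable2_def by blast
  from ev_comp2[OF this] show ?thesis unfolding computable2_def by blast
qed

lemma computable2_fst: "computable2 (\<lambda>a b. a)" and computable2_snd: "computable2 (\<lambda>a b. b)"
  unfolding computable2_def using ev_proj0 ev_proj1 by metis+

lemma computable2_rec:
  assumes "computable nat_enc nat_enc f" and "computable2 g"
  shows "computable2 (\<lambda>n a. rec_nat (f a) g n)"
proof -
  obtain F G where "\<And>x. eval_recf F [x] (f x)" "\<And>a b. eval_recf G [a, b] (g a b)"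
    using assms unfolding computable_def computable2_def id_apply by blast
  \<comment> \<open>\<open>RPrim\<close> passes the previous value before the counter, whereas
    \<open>rec_nat\<close> expects the counter first; the projections swap the two and drop the
    parameter.\<close>
  then have "eval_recf (RPrim F (RComp G [RProj 1, RProj 0])) [n, a] (rec_nat (f a) g n)" for n a
    by (intro ev_prim_rec) (rule ev_comp2 ev_proj0 ev_proj1 | assumption)+
  then show ?thesis unfolding computable2_def by blast
qed

lemma computable2_add: "computable2 (+)"
proof -
  have "(\<lambda>n a. rec_nat a (\<lambda>_ y. Suc y) n) = (+)"
    by (intro ext, rename_tac n a, induct_tac n) auto
  moreover have "computable2 (\<lambda>_ y. Suc y)"
    by (intro computable2_comp[of Suc] computable2_snd computable_intros)
  ultimately show ?thesis
    using computable2_rec[OF computable_id] by metis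
qed

text \<open>The recursion that returns its own counter is the predecessor function, and truncated
  subtraction iterates it.\<close>

lemma computable2_diff: "computable2 (-)"
proof -
  have "(\<lambda>n (a::nat). rec_nat 0 (\<lambda>k _. k) n) = (\<lambda>n a. n - 1)"
    by (intro ext, rename_tac n a, case_tac n) auto
  with computable2_rec[of "\<lambda>a. 0" "\<lambda>k _. k"] have "computable2 (\<lambda>n a. n - 1)"
    by (auto intro: computable_intros computable2_fst)
  then have "computable2 (\<lambda>k y. y - 1)"
    using computable2_comp2[OF _ computable2_snd computable2_snd] by blast
  moreover have "(\<lambda>n a. rec_nat a (\<lambda>_ y. y - 1) n) = (\<lambda>n a. a - n)"
    by (intro ext, rename_tac n a, induct_tac n) auto
  ultimately have "computable2 (\<lambda>n a. a - n)"
    using computable2_rec[of "\<lambda>a. a" "\<lambda>_ y. y - 1"] by (auto intro: computable_intros)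
  from computable2_comp2[OF this computable2_snd computable2_fst] show ?thesis .
qed

lemma computable_triangle: "computable nat_enc nat_enc triangle"
proof -
  have "(\<lambda>n (a::nat). rec_nat 0 (\<lambda>k y. y + Suc k) n) = (\<lambda>n a. triangle n)"
    by (intro ext, rename_tac n a, induct_tac n) (auto simp: triangle_Suc)
  moreover have "computable2 (\<lambda>k y. y + Suc k)"
    by (intro computable2_comp2[OF computable2_add] computable2_comp[of Suc] computable2_fst computable2_snd
        computable_intros)
  ultimately have "computable2 (\<lambda>n a. triangle n)"
    using computable2_rec[of "\<lambda>a. 0" "\<lambda>k y. y + Suc k"] by (auto intro: computable_intros)
  then show ?thesis
    using computable_binary[OF _ computable_id computable_id] by blast
qed

lemma computable_add [computable_intros]:
  "computable e nat_enc f \<Longrightarrow> computable e nat_enc g \<Longrightarrow> computable e nat_enc (\<lambda>x. f x + g x)"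
  by (rule computable_binary[OF computable2_add])

lemma computable_diff [computable_intros]:
  "computable e nat_enc f \<Longrightarrow> computable e nat_enc g \<Longrightarrow> computable e nat_enc (\<lambda>x. f x - g x)"
  by (rule computable_binary[OF computable2_diff])

section \<open>Pairs, unbounded search and conditionals\<close>

lemma computable2_prod_encode: "computable2 (\<lambda>m n. prod_encode (m, n))"
proof -
  have "computable2 (\<lambda>m n. triangle (m + n) + m)"
    by (intro computable2_comp2[OF computable2_add] computable2_comp[OF computable_triangle]
        computable2_fst computable2_snd)
  then show ?thesis by (simp add: prod_encode_def)
qed

lemma computable_Pair [computable_intros]:
  assumes "computable e a f" "computable e b g"
  shows "computable e (prod_enc a b) (\<lambda>x. (f x, g x))"
  by (rule computable_cong_code[OF computable_binary[OF computable2_prod_encode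
        computable_code[OF assms(1)] computable_code[OF assms(2)]]]) (simp add: prod_enc_def)

text \<open>\<open>RMin\<close> looks for a zero, so the truth value is inverted. The test converges
  for all arguments, hence the search meets no undefined value before the first success.\<close>

lemma computable_minimization:
  assumes "computable (prod_enc nat_enc e) bool_enc (\<lambda>p. P (fst p) (snd p))"
  shows "\<exists>F. \<forall>x. (\<exists>n. P n x) \<longrightarrow> eval_recf F [e x] (LEAST n. P n x)"
proof -
  have "computable (prod_enc nat_enc e) nat_enc (\<lambda>p. 1 - bool_enc (P (fst p) (snd p)))"
    by (intro computable_diff computable_const computable_code[OF assms])
  moreover note computable2_prod_encode
  ultimately obtain F H where
    F: "\<And>p. eval_recf F [prod_enc nat_enc e p] (1 - bool_enc (P (fst p) (snd p)))"
    and H: "\<And>a b. eval_recf H [a, b] (prod_encode (a, b))"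
    unfolding computable_def computable2_def id_apply by blast
  let ?G = "RComp F [H]"
  have G: "eval_recf ?G [n, e x] (1 - bool_enc (P n x))" for n x
    using ev_comp1[OF H] F[of "(n, x)"] by (simp add: prod_enc_def)
  have "eval_recf (RMin ?G) [e x] (LEAST n. P n x)" if "\<exists>n. P n x" for x
  proof (rule ev_min)
    show "eval_recf ?G ((LEAST n. P n x) # [e x]) 0"
      using G[of "LEAST n. P n x" x] LeastI_ex[OF that] by (simp add: bool_enc_def)
    show "\<forall>m<LEAST n. P n x. \<exists>y. eval_recf ?G (m # [e x]) (Suc y)"
    proof (intro allI impI)
      fix m assume "m < (LEAST n. P n x)"
      then have "\<not> P m x" by (rule not_less_Least)
      then show "\<exists>y. eval_recf ?G (m # [e x]) (Suc y)"
        using G[of m x] by (auto simp: bool_enc_def)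
    qed
  qed
  then show ?thesis by blast
qed

text \<open>The code of \<open>(m, n)\<close> lies on the diagonal that starts at
  \<open>triangle (m + n)\<close>. Hence \<open>m + n\<close> is the least \<open>s\<close> such
  that the code is below \<open>triangle (Suc s)\<close>, and minimization finds it. Subtraction
  then gives \<open>m\<close> and, from the sum, \<open>n\<close>.\<close>

lemma computable_fst_snd_id:
  "computable (prod_enc a b) a fst" (is ?A) "computable (prod_enc a b) b snd" (is ?B)
proof -
  have "computable2 (\<lambda>s z. Suc z - triangle (Suc s))"
    by (intro computable2_comp2[OF computable2_diff] computable2_comp[OF computable_triangle]
        computable2_comp[of Suc] computable2_fst computable2_snd computable_intros)
  then obtain G where G: "\<And>s z. eval_recf G [s, z] (Suc z - triangle (Suc s))"
    unfolding computable2_def by blast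
  have tri_mono: "triangle i \<le> triangle j" if "i \<le> j" for i j
    using that by (induction rule: dec_induct) auto
  have root: "eval_recf (RMin G) [prod_encode (m, n)] (m + n)" for m n
  proof (rule ev_min)
    have "Suc (prod_encode (m, n)) - triangle (Suc (m + n)) = 0"
      by (simp add: prod_encode_def)
    then show "eval_recf G ((m + n) # [prod_encode (m, n)]) 0"
      using G[of "m + n" "prod_encode (m, n)"] by metis
    show "\<forall>s<m + n. \<exists>y. eval_recf G (s # [prod_encode (m, n)]) (Suc y)"
    proof (intro allI impI)
      fix s assume "s < m + n"
      then have "triangle (Suc s) \<le> prod_encode (m, n)"
        using tri_mono[of "Suc s" "m + n"] by (simp add: prod_encode_def)
      then have "Suc (prod_encode (m, n)) - triangle (Suc s)
          = Suc (prod_encode (m, n) - triangle (Suc s))" by (rule Suc_diff_le)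
      then show "\<exists>y. eval_recf G (s # [prod_encode (m, n)]) (Suc y)"
        using G[of s "prod_encode (m, n)"] by metis
    qed
  qed
  have sum: "computable (prod_enc a b) nat_enc (\<lambda>p. a (fst p) + b (snd p))"
    unfolding computable_def prod_enc_def id_apply using root by blast
  have code: "computable (prod_enc a b) nat_enc (prod_enc a b)"
    by (rule computable_code[OF computable_id])
  have "computable (prod_enc a b) nat_enc
      (\<lambda>p. prod_enc a b p - triangle (a (fst p) + b (snd p)))"
    by (intro computable_intros code computable_comp[OF computable_triangle sum])
  then show ?A
    by (rule computable_cong_code) (simp add: prod_enc_def prod_encode_def)
  from sum computable_code[OF this] have "computable (prod_enc a b) nat_enc (\<lambda>p. (a (fst p) + b (snd p)) - a (fst p))"
    by (rule computable_diff)
  then show ?B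
    by (rule computable_cong_code) simp
qed

lemma computable_fst [computable_intros]:
  "computable e (prod_enc a b) f \<Longrightarrow> computable e a (\<lambda>x. fst (f x))"
  by (rule computable_comp[OF computable_fst_snd_id(1)])

lemma computable_snd [computable_intros]:
  "computable e (prod_enc a b) f \<Longrightarrow> computable e b (\<lambda>x. snd (f x))"
  by (rule computable_comp[OF computable_fst_snd_id(2)])

lemma computable_rec_nat [computable_intros]:
  assumes "computable e nat_enc n" and "computable e d z"
    and "computable (prod_enc e (prod_enc nat_enc d)) d (\<lambda>p. h (fst p) (fst (snd p)) (snd (snd p)))"
  shows "computable e d (\<lambda>x. rec_nat (z x) (h x) (n x))"
proof -
  obtain H where H: "\<And>a b. eval_recf H [a, b] (prod_encode (a, b))"
    using computable2_prod_encode unfolding computable2_def by blast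
  obtain N Z S where N: "\<And>x. eval_recf N [e x] (n x)" and Z: "\<And>x. eval_recf Z [e x] (d (z x))"
    and S: "\<And>p. eval_recf S [prod_enc e (prod_enc nat_enc d) p] (d (h (fst p) (fst (snd p)) (snd (snd p))))"
    using assms unfolding computable_def id_apply by blast
  \<comment> \<open>The arguments arrive as value, counter, parameter and are regrouped into the
    nested pair that \<open>S\<close> expects.\<close>
  let ?P = "RComp S [RComp H [RProj 2, RComp H [RProj 1, RProj 0]]]"
  have S': "eval_recf ?P [d y, k, e x] (d (h x k y))" for x k y
    using S[of "(x, k, y)"] unfolding prod_enc_def
    by (intro ev_comp1[OF ev_comp2[OF ev_proj2 ev_comp2[OF ev_proj1 ev_proj0 H] H]]) simp
  have "eval_recf (RPrim Z ?P) [m, e x] (d (rec_nat (z x) (h x) m))" for m x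
  proof (induction m)
    case 0
    show ?case using ev_prim0[OF Z] by simp
  next
    case (Suc m)
    show ?case using ev_primS[OF Suc S'] by simp
  qed
  then have "eval_recf (RComp (RPrim Z ?P) [N, RProj 0]) [e x] (d (rec_nat (z x) (h x) (n x)))" for x
    by (intro ev_comp2[OF N ev_proj0])
  then show ?thesis unfolding computable_def by blast
qed

lemma computable_case_nat [computable_intros]:
  assumes "computable e nat_enc n" and "computable e d z"
    and "computable (prod_enc e nat_enc) d (\<lambda>p. h (fst p) (snd p))"
  shows "computable e d (\<lambda>x. case n x of 0 \<Rightarrow> z x | Suc m \<Rightarrow> h x m)"
proof -
  have "computable (prod_enc e (prod_enc nat_enc d)) (prod_enc e nat_enc) (\<lambda>p. (fst p, fst (snd p)))"
    by (rule computable_intros)+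
  from computable_comp[OF assms(3) this]
  have "computable (prod_enc e (prod_enc nat_enc d)) d (\<lambda>p. h (fst p) (fst (snd p)))"
    by simp
  then have "computable e d (\<lambda>x. rec_nat (z x) (\<lambda>k y. h x k) (n x))"
    using assms by (intro computable_intros) auto
  moreover have "(\<lambda>x. rec_nat (z x) (\<lambda>k y. h x k) (n x)) = (\<lambda>x. case n x of 0 \<Rightarrow> z x | Suc m \<Rightarrow> h x m)"
    by (auto split: nat.split)
  ultimately show ?thesis by simp
qed

lemma computable_If [computable_intros]:
  assumes "computable e bool_enc b" and "computable e d f" and "computable e d g"
  shows "computable e d (\<lambda>x. if b x then f x else g x)"
proof -
  have "computable (prod_enc e nat_enc) d (\<lambda>p. f (fst p))"
    by (rule computable_comp[OF assms(2)], (rule computable_intros)+)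
  then have "computable e d (\<lambda>x. case bool_enc (b x) of 0 \<Rightarrow> g x | Suc m \<Rightarrow> f x)"
    by (intro computable_case_nat computable_code[OF assms(1)] assms(3))
  then show ?thesis by (rule computable_cong_code) (simp add: bool_enc_def)
qed

lemma computable_not [computable_intros]:
  assumes "computable e bool_enc b"
  shows "computable e bool_enc (\<lambda>x. \<not> b x)"
  using computable_If[OF assms computable_const[of _ bool_enc False] computable_const[of _ bool_enc True]]
  by (rule computable_cong_code[where d = bool_enc]) simp_all

lemma computable_conj [computable_intros]:
  assumes "computable e bool_enc b" "computable e bool_enc c"
  shows "computable e bool_enc (\<lambda>x. b x \<and> c x)"
  by (rule computable_cong_code[OF computable_If[OF assms computable_const[of _ _ False]]]) simp

lemma computable_disj [computable_intros]:
  assumes "computable e bool_enc b" "computable e bool_enc c"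
  shows "computable e bool_enc (\<lambda>x. b x \<or> c x)"
  by (rule computable_cong_code[OF computable_If[OF assms(1) computable_const[of _ _ True] assms(2)]]) simp

lemma computable_imp [computable_intros]:
  assumes "computable e bool_enc b" "computable e bool_enc c"
  shows "computable e bool_enc (\<lambda>x. b x \<longrightarrow> c x)"
  by (rule computable_cong_code[OF computable_If[OF assms computable_const[of _ _ True]]]) simp

text \<open>The two truncated differences of the codes are both zero iff the codes agree;
  injectivity of the encoder carries this over to the values.\<close>

lemma computable_eq [computable_intros]:
  assumes "computable e d f" "computable e d g" "inj d"
  shows "computable e bool_enc (\<lambda>x. f x = g x)"
proof -
  let ?n = "\<lambda>x. (d (f x) - d (g x)) + (d (g x) - d (f x))"
  have "computable e bool_enc (\<lambda>x. case ?n x of 0 \<Rightarrow> True | Suc _ \<Rightarrow> False)"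
    by (intro computable_case_nat computable_add computable_diff computable_const
        computable_code[OF assms(1)] computable_code[OF assms(2)])
  then show ?thesis
  proof (rule computable_cong_code)
    fix x
    have "?n x = 0 \<longleftrightarrow> f x = g x"
      using inj_eq[OF assms(3)] by auto
    then show "bool_enc (f x = g x) = bool_enc (case ?n x of 0 \<Rightarrow> True | Suc _ \<Rightarrow> False)"
      by (cases "?n x") simp_all
  qed
qed

lemma inj_nat_enc [computable_intros]: "inj nat_enc"
  by simp

lemma inj_prod_enc [computable_intros]: "inj a \<Longrightarrow> inj b \<Longrightarrow> inj (prod_enc a b)"
  unfolding inj_def prod_enc_def by auto

lemma inj_list_enc [computable_intros]: "inj a \<Longrightarrow> inj (list_enc a)"
  by (rule injI) (simp add: list_enc_def list_encode_eq inj_map_eq_map)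

section \<open>Encoded lists and bounded quantifiers\<close>

lemma list_enc_Nil [simp]: "list_enc a [] = 0"
  by (simp add: list_enc_def)

lemma list_enc_Cons [simp]: "list_enc a (y # ys) = Suc (prod_encode (a y, list_enc a ys))"
  by (simp add: list_enc_def)

lemma length_le_list_enc: "length xs \<le> list_enc a xs"
proof (induction xs)
  case (Cons y ys)
  then show ?case using le_prod_encode_2[of "list_enc a ys" "a y"] by simp
qed simp

lemma computable_Cons [computable_intros]:
  assumes "computable e a f" "computable e (list_enc a) g"
  shows "computable e (list_enc a) (\<lambda>x. f x # g x)"
  by (rule computable_cong_code[OF computable_Suc[OF computable_code[OF computable_Pair[OF assms]]]])
    (simp add: prod_enc_def)

lemma computable_prod_decode:
  "computable nat_enc nat_enc (\<lambda>m. fst (prod_decode m))"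
  "computable nat_enc nat_enc (\<lambda>m. snd (prod_decode m))"
proof -
  have 1: "prod_enc nat_enc nat_enc (prod_decode m) = m" for m
    by (simp add: prod_enc_def)
  have "computable nat_enc (prod_enc nat_enc nat_enc) prod_decode"
    by (rule computable_cong_code[OF computable_id[of nat_enc]]) (simp add: 1)
  from computable_fst[OF this] computable_snd[OF this]
  show "computable nat_enc nat_enc (\<lambda>m. fst (prod_decode m))"
    "computable nat_enc nat_enc (\<lambda>m. snd (prod_decode m))" .
qed

text \<open>A recursive function is only known to converge on codes of values, so a case distinction on a
  list cannot recurse through arbitrary smaller numbers; it is reduced to a conditional, a head with a
  default value, and a tail.\<close>

lemma computable_hd_tl:
  "computable (list_enc a) a (\<lambda>xs. case xs of [] \<Rightarrow> c | y # _ \<Rightarrow> y)" (is ?A)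
  "computable (list_enc a) (list_enc a) tl" (is ?B)
proof -
  have id: "computable (list_enc a) nat_enc (list_enc a)"
    by (rule computable_code[OF computable_id])
  have "computable (list_enc a) nat_enc
      (\<lambda>xs. case list_enc a xs of 0 \<Rightarrow> a c | Suc m \<Rightarrow> fst (prod_decode m))"
    by (rule computable_case_nat[OF id computable_const])
      (rule computable_comp[OF computable_prod_decode(1)] computable_intros)+
  then show ?A
    by (rule computable_cong_code) (simp split: list.split)
  have "computable (list_enc a) nat_enc
      (\<lambda>xs. case list_enc a xs of 0 \<Rightarrow> 0 | Suc m \<Rightarrow> snd (prod_decode m))"
    by (rule computable_case_nat[OF id computable_const])
      (rule computable_comp[OF computable_prod_decode(2)] computable_intros)+
  then show ?B
    by (rule computable_cong_code, rename_tac xs, case_tac xs) simp_all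
qed

lemma computable_tl [computable_intros]:
  "computable e (list_enc a) f \<Longrightarrow> computable e (list_enc a) (\<lambda>x. tl (f x))"
  by (rule computable_comp[OF computable_hd_tl(2)])

lemma computable_is_Nil:
  assumes "computable e (list_enc a) f"
  shows "computable e bool_enc (\<lambda>x. f x = [])"
proof -
  have "computable e bool_enc (\<lambda>x. case list_enc a (f x) of 0 \<Rightarrow> True | Suc _ \<Rightarrow> False)"
    by (rule computable_intros computable_code[OF assms])+
  then show ?thesis
    by (rule computable_cong_code, rename_tac x, case_tac "f x") simp_all
qed

lemma computable_case_list [computable_intros]:
  assumes xs: "computable e (list_enc a) xs" and f: "computable e d f"
    and g: "computable (prod_enc e (prod_enc a (list_enc a))) d (\<lambda>p. g (fst p) (fst (snd p)) (snd (snd p)))"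
  shows "computable e d (\<lambda>x. case xs x of [] \<Rightarrow> f x | y # ys \<Rightarrow> g x y ys)"
proof -
  have "computable e (prod_enc e (prod_enc a (list_enc a)))
      (\<lambda>x. (x, (case xs x of [] \<Rightarrow> undefined | y # _ \<Rightarrow> y), tl (xs x)))"
    by (rule computable_intros computable_comp[OF computable_hd_tl(1) xs] xs)+
  from computable_comp[OF g this]
  have "computable e d (\<lambda>x. if xs x = [] then f x
      else g x (case xs x of [] \<Rightarrow> undefined | y # _ \<Rightarrow> y) (tl (xs x)))"
    by (intro computable_If computable_is_Nil[OF xs] f) simp
  then show ?thesis
    by (rule computable_cong_code, rename_tac x, case_tac "xs x") simp_all
qed

lemma computable_foldl [computable_intros]:
  assumes xs: "computable e (list_enc a) xs" and z: "computable e d z"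
    and h: "computable (prod_enc e (prod_enc d a)) d (\<lambda>p. h (fst p) (fst (snd p)) (snd (snd p)))"
  shows "computable e d (\<lambda>x. foldl (h x) (z x) (xs x))"
proof -
  \<comment> \<open>The code of a list bounds its length, so it serves as the number of iterations; surplus rounds
    leave the state unchanged.\<close>
  let ?s = "\<lambda>x k st. case snd st of [] \<Rightarrow> st | y # ys \<Rightarrow> (h x (fst st) y, ys)"
  have iter: "rec_nat (b, ys) (?s x) n = (foldl (h x) b (take n ys), drop n ys)" for x b ys n
  proof (induction n)
    case (Suc n)
    show ?case
    proof (cases "drop n ys")
      case Nil
      then show ?thesis using Suc by simp
    next
      case (Cons w ws)
      then have "n < length ys" "ys ! n = w" "drop (Suc n) ys = ws"
        by (metis drop_all leI list.discI, metis drop_all hd_drop_conv_nth leI list.discI list.sel(1),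
            metis drop_Suc list.sel(3) tl_drop)
      then show ?thesis using Suc Cons by (simp add: take_Suc_conv_app_nth)
    qed
  qed simp
  let ?e = "prod_enc e (prod_enc nat_enc (prod_enc d (list_enc a)))"
  have "computable (prod_enc ?e (prod_enc a (list_enc a))) (prod_enc e (prod_enc d a))
      (\<lambda>p. (fst (fst p), fst (snd (snd (fst p))), fst (snd p)))"
    by (rule computable_intros)+
  from computable_comp[OF h this]
  have "computable (prod_enc ?e (prod_enc a (list_enc a))) d
      (\<lambda>p. h (fst (fst p)) (fst (snd (snd (fst p)))) (fst (snd p)))"
    by simp
  then have step: "computable ?e (prod_enc d (list_enc a)) (\<lambda>p. ?s (fst p) (fst (snd p)) (snd (snd p)))"
    by - (rule computable_intros | assumption)+
  have "computable e d (\<lambda>x. fst (rec_nat (z x, xs x) (?s x) (list_enc a (xs x))))"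
    by (intro computable_fst[OF computable_rec_nat[OF computable_code[OF xs] computable_Pair[OF z xs] step]])
  then show ?thesis
    by (simp add: iter length_le_list_enc)
qed

lemma computable_rev [computable_intros]:
  assumes "computable e (list_enc a) f"
  shows "computable e (list_enc a) (\<lambda>x. rev (f x))"
proof -
  have "computable e (list_enc a) (\<lambda>x. foldl (\<lambda>ys y. y # ys) [] (f x))"
    by (rule computable_intros assms)+
  moreover have "foldl (\<lambda>ys y. y # ys) zs xs = rev xs @ zs" for xs zs :: "'b list"
    by (induction xs arbitrary: zs) simp_all
  ultimately show ?thesis by simp
qed

lemma computable_foldr [computable_intros]:
  assumes xs: "computable e (list_enc a) xs" and z: "computable e d z"
    and h: "computable (prod_enc e (prod_enc a d)) d (\<lambda>p. h (fst p) (fst (snd p)) (snd (snd p)))"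
  shows "computable e d (\<lambda>x. foldr (h x) (xs x) (z x))"
proof -
  have "computable (prod_enc e (prod_enc d a)) (prod_enc e (prod_enc a d))
      (\<lambda>p. (fst p, snd (snd p), fst (snd p)))"
    by (rule computable_intros)+
  from computable_comp[OF h this]
  have "computable (prod_enc e (prod_enc d a)) d (\<lambda>p. h (fst p) (snd (snd p)) (fst (snd p)))"
    by simp
  then show ?thesis
    unfolding foldr_conv_foldl by - (rule computable_intros assms | assumption)+
qed

lemma computable_append [computable_intros]:
  assumes "computable e (list_enc a) f" "computable e (list_enc a) g"
  shows "computable e (list_enc a) (\<lambda>x. f x @ g x)"
proof -
  have "computable e (list_enc a) (\<lambda>x. foldr (\<lambda>y ys. y # ys) (f x) (g x))"
    by (rule computable_intros assms)+
  moreover have "foldr (\<lambda>y ys. y # ys) xs ys = xs @ ys" for xs ys :: "'b list"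
    by (induction xs) simp_all
  ultimately show ?thesis by simp
qed

lemma computable_concat [computable_intros]:
  assumes "computable e (list_enc (list_enc a)) f"
  shows "computable e (list_enc a) (\<lambda>x. concat (f x))"
  unfolding concat_conv_foldr by (rule computable_intros assms)+

lemma computable_map [computable_intros]:
  assumes f: "computable e (list_enc a) f" and g: "computable (prod_enc e a) d (\<lambda>p. g (fst p) (snd p))"
  shows "computable e (list_enc d) (\<lambda>x. map (g x) (f x))"
proof -
  have "computable (prod_enc e (prod_enc a (list_enc d))) (prod_enc e a) (\<lambda>p. (fst p, fst (snd p)))"
    by (rule computable_intros)+
  from computable_comp[OF g this]
  have "computable (prod_enc e (prod_enc a (list_enc d))) d (\<lambda>p. g (fst p) (fst (snd p)))"
    by simp
  then have "computable e (list_enc d) (\<lambda>x. foldr (\<lambda>y ys. g x y # ys) (f x) [])"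
    by - (rule computable_intros f | assumption)+
  moreover have "foldr (\<lambda>y ys. k y # ys) xs [] = map k xs" for k :: "'b \<Rightarrow> 'c" and xs
    by (induction xs) simp_all
  ultimately show ?thesis by simp
qed

lemma computable_filter [computable_intros]:
  assumes f: "computable e (list_enc a) f" and g: "computable (prod_enc e a) bool_enc (\<lambda>p. P (fst p) (snd p))"
  shows "computable e (list_enc a) (\<lambda>x. filter (P x) (f x))"
proof -
  have "computable e (list_enc a) (\<lambda>x. concat (map (\<lambda>y. if P x y then [y] else []) (f x)))"
    by (rule computable_intros f g)+
  moreover have "concat (map (\<lambda>y. if Q y then [y] else []) xs) = filter Q xs" for Q and xs :: "'b list"
    by (induction xs) simp_all
  ultimately show ?thesis by simp
qed

lemma computable_Bex_set [computable_intros]: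
  assumes f: "computable e (list_enc a) f" and g: "computable (prod_enc e a) bool_enc (\<lambda>p. P (fst p) (snd p))"
  shows "computable e bool_enc (\<lambda>x. \<exists>y\<in>set (f x). P x y)"
proof -
  have "computable e bool_enc (\<lambda>x. \<not> filter (P x) (f x) = [])"
    by (rule computable_intros computable_is_Nil f g)+
  moreover have "(\<not> filter Q xs = []) = (\<exists>y\<in>set xs. Q y)" for Q and xs :: "'b list"
    by (induction xs) simp_all
  ultimately show ?thesis by simp
qed

lemma computable_Ball_set [computable_intros]:
  assumes f: "computable e (list_enc a) f" and g: "computable (prod_enc e a) bool_enc (\<lambda>p. P (fst p) (snd p))"
  shows "computable e bool_enc (\<lambda>x. \<forall>y\<in>set (f x). P x y)"
proof -
  have "computable e bool_enc (\<lambda>x. \<not> (\<exists>y\<in>set (f x). \<not> P x y))"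
    by (rule computable_intros f g)+
  then show ?thesis by simp
qed

lemma computable_member [computable_intros]:
  assumes "computable e (list_enc a) f" "computable e a g" "inj a"
  shows "computable e bool_enc (\<lambda>x. g x \<in> set (f x))"
proof -
  have "computable (prod_enc e a) a (\<lambda>p. g (fst p))"
    by (rule computable_comp[OF assms(2)] computable_intros)+
  then have "computable e bool_enc (\<lambda>x. \<exists>y\<in>set (f x). g x = y)"
    by - (rule computable_intros assms | assumption)+
  then show ?thesis by simp
qed

lemma computable_length [computable_intros]:
  assumes "computable e (list_enc a) f"
  shows "computable e nat_enc (\<lambda>x. length (f x))"
proof -
  have "computable e nat_enc (\<lambda>x. foldr (\<lambda>_ n. Suc n) (f x) 0)"
    by (rule computable_intros assms)+
  moreover have "foldr (\<lambda>_ n. Suc n) xs 0 = length xs" for xs :: "'b list"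
    by (induction xs) simp_all
  ultimately show ?thesis by simp
qed

lemma computable_upt [computable_intros]:
  assumes "computable e nat_enc f"
  shows "computable e (list_enc nat_enc) (\<lambda>x. [0..<f x])"
proof -
  have "computable e (list_enc nat_enc) (\<lambda>x. rec_nat [] (\<lambda>n ys. ys @ [n]) (f x))"
    by (rule computable_intros assms)+
  moreover have "rec_nat [] (\<lambda>n ys. ys @ [n]) n = [0..<n]" for n
    by (induction n) simp_all
  ultimately show ?thesis by simp
qed

lemma computable_All_less [computable_intros]:
  assumes "computable e nat_enc f" "computable (prod_enc e nat_enc) bool_enc (\<lambda>p. P (fst p) (snd p))"
  shows "computable e bool_enc (\<lambda>x. \<forall>i<f x. P x i)"
proof -
  have "computable e bool_enc (\<lambda>x. \<forall>i\<in>set [0..<f x]. P x i)"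
    by (rule computable_intros assms)+
  then show ?thesis by (simp add: atLeast0LessThan Ball_def)
qed

lemma computable_Ex_less [computable_intros]:
  assumes "computable e nat_enc f" "computable (prod_enc e nat_enc) bool_enc (\<lambda>p. P (fst p) (snd p))"
  shows "computable e bool_enc (\<lambda>x. \<exists>i<f x. P x i)"
proof -
  have "computable e bool_enc (\<lambda>x. \<exists>i\<in>set [0..<f x]. P x i)"
    by (rule computable_intros assms)+
  then show ?thesis by (simp add: atLeast0LessThan Bex_def)
qed

lemma computable_drop [computable_intros]:
  assumes "computable e nat_enc n" "computable e (list_enc a) f"
  shows "computable e (list_enc a) (\<lambda>x. drop (n x) (f x))"
proof -
  have "computable e (list_enc a) (\<lambda>x. rec_nat (f x) (\<lambda>_ ys. tl ys) (n x))"
    by (rule computable_intros assms)+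
  moreover have "rec_nat xs (\<lambda>_ ys. tl ys) k = drop k xs" for k and xs :: "'b list"
    by (induction k) (simp_all add: drop_Suc tl_drop)
  ultimately show ?thesis by simp
qed

lemma computable_take [computable_intros]:
  assumes "computable e nat_enc n" "computable e (list_enc a) f"
  shows "computable e (list_enc a) (\<lambda>x. take (n x) (f x))"
proof -
  have "computable e (list_enc a) (\<lambda>x. rev (drop (length (f x) - n x) (rev (f x))))"
    by (rule computable_intros assms)+
  moreover have "take (length xs - (length xs - k)) xs = take k xs" for k and xs :: "'b list"
    by (cases "k \<le> length xs") simp_all
  ultimately show ?thesis by (simp add: rev_drop)
qed

text \<open>Replaces \<^term>\<open>(!)\<close>, whose unspecified values out of range cannot be shown computable.\<close>

definition nth_or :: "'a \<Rightarrow> 'a list \<Rightarrow> nat \<Rightarrow> 'a" where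
  "nth_or c xs i = (case drop i xs of [] \<Rightarrow> c | y # _ \<Rightarrow> y)"

lemma nth_or_eq [simp]: "i < length xs \<Longrightarrow> nth_or c xs i = xs ! i"
  by (simp add: nth_or_def Cons_nth_drop_Suc[symmetric])

lemma computable_nth_or [computable_intros]:
  assumes "computable e nat_enc n" "computable e (list_enc a) f"
  shows "computable e a (\<lambda>x. nth_or c (f x) (n x))"
  unfolding nth_or_def by (rule computable_intros assms)+

lemma computable_list_update [computable_intros]:
  assumes n: "computable e nat_enc n" and f: "computable e (list_enc a) f" and g: "computable e a g"
  shows "computable e (list_enc a) (\<lambda>x. (f x)[n x := g x])"
proof -
  have "computable (prod_enc e (prod_enc a (list_enc a))) a (\<lambda>p. g (fst p))"
    by (rule computable_comp[OF g] computable_intros)+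
  then have "computable e (list_enc a)
      (\<lambda>x. take (n x) (f x) @ (case drop (n x) (f x) of [] \<Rightarrow> [] | y # ys \<Rightarrow> g x # ys))"
    by - (rule computable_intros assms | assumption)+
  moreover have "take k xs @ (case drop k xs of [] \<Rightarrow> [] | y # ys \<Rightarrow> v # ys) = xs[k := v]"
    for k v and xs :: "'b list"
    by (induction xs arbitrary: k) (simp_all split: nat.split add: take_Cons drop_Cons)
  ultimately show ?thesis by simp
qed

text \<open>Turns a fact about a curried function on pairs into a rule for arbitrary argument terms,
  so that later definitions are handled by their syntax alone.\<close>

lemma computable_app2:
  assumes "computable (prod_enc a b) d (\<lambda>p. h (fst p) (snd p))"
    and "computable e a f" "computable e b g"
  shows "computable e d (\<lambda>x. h (f x) (g x))"
  using computable_comp[OF assms(1) computable_Pair[OF assms(2,3)]] by simp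

lemma computable_app3:
  assumes "computable (prod_enc a (prod_enc b c)) d (\<lambda>p. h (fst p) (fst (snd p)) (snd (snd p)))"
    and "computable e a f" "computable e b g" "computable e c k"
  shows "computable e d (\<lambda>x. h (f x) (g x) (k x))"
  using computable_comp[OF assms(1) computable_Pair[OF assms(2) computable_Pair[OF assms(3,4)]]] by simp

lemma computable_app4:
  assumes "computable (prod_enc a (prod_enc b (prod_enc c k))) d
      (\<lambda>p. h (fst p) (fst (snd p)) (fst (snd (snd p))) (snd (snd (snd p))))"
    and "computable e a f" "computable e b g" "computable e c u" "computable e k v"
  shows "computable e d (\<lambda>x. h (f x) (g x) (u x) (v x))"
  using computable_comp[OF assms(1)
      computable_Pair[OF assms(2) computable_Pair[OF assms(3) computable_Pair[OF assms(4,5)]]]]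
  by simp

section \<open>The product of the machine and the automata\<close>

type_synonym transition = "nat \<times> act \<times> nat"
type_synonym pstate = "nat \<times> nat list list \<times> nat list list"

fun is_send :: "act \<Rightarrow> bool" where
  "is_send (Send _ _) = True" | "is_send (Recv _ _) = False"

fun chan :: "act \<Rightarrow> nat" where
  "chan (Send c _) = c" | "chan (Recv c _) = c"

fun letter :: "act \<Rightarrow> nat" where
  "letter (Send _ a) = a" | "letter (Recv _ a) = a"

definition src :: "transition \<Rightarrow> nat" where "src d = fst d"
definition act :: "transition \<Rightarrow> act" where "act d = fst (snd d)"
definition tgt :: "transition \<Rightarrow> nat" where "tgt d = snd (snd d)"

definition sends :: "nat \<Rightarrow> transition list \<Rightarrow> nat list" where
  "sends c \<pi> = concat (map (\<lambda>d. if is_send (act d) \<and> chan (act d) = c then [letter (act d)] else []) \<pi>)"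

definition arc_src :: "nat \<times> nat \<times> nat \<Rightarrow> nat" where "arc_src t = fst t"
definition arc_letter :: "nat \<times> nat \<times> nat \<Rightarrow> nat" where "arc_letter t = fst (snd t)"
definition arc_tgt :: "nat \<times> nat \<times> nat \<Rightarrow> nat" where "arc_tgt t = snd (snd t)"

text \<open>Filtering a fixed list leaves only finitely many possible values for the lists of automaton states.\<close>

definition nfa_step :: "nfa \<Rightarrow> nat list \<Rightarrow> nat \<Rightarrow> nat list" where
  "nfa_step A S x = filter (\<lambda>q. \<exists>t\<in>set (n_trans A). arc_src t \<in> set S \<and> arc_letter t = x \<and> arc_tgt t = q)
     (map arc_tgt (n_trans A))"

definition coreach_upto :: "nfa \<Rightarrow> nat \<Rightarrow> nat list" where
  "coreach_upto A n =
     rec_nat (n_final A) (\<lambda>_ C. C @ map arc_src (filter (\<lambda>t. arc_tgt t \<in> set C) (n_trans A))) n"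

text \<open>The number of iterations bounds the size of the set of states that can occur.\<close>

definition coreach :: "nfa \<Rightarrow> nat list" where
  "coreach A = coreach_upto A (length (n_final A) + length (n_trans A))"

definition viable :: "nfa \<Rightarrow> nat list \<Rightarrow> bool" where
  "viable A S \<longleftrightarrow> (\<exists>q\<in>set S. q \<in> set (coreach A))"

definition aut :: "fifo \<times> nfa list \<Rightarrow> nat \<Rightarrow> nfa" where
  "aut I c = nth_or (NFA [] [] []) (snd I) c"

definition content :: "pstate \<Rightarrow> nat \<Rightarrow> nat list" where
  "content s c = nth_or [] (fst (snd s)) c"

definition nstates :: "pstate \<Rightarrow> nat \<Rightarrow> nat list" where
  "nstates s c = nth_or [] (snd (snd s)) c"

definition start :: "fifo \<times> nfa list \<Rightarrow> pstate" where
  "start I = (q0 (fst I), map (\<lambda>_. []) [0..<nch (fst I)], map n_init (snd I))"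

definition next_nstates :: "fifo \<times> nfa list \<Rightarrow> pstate \<Rightarrow> act \<Rightarrow> nat list" where
  "next_nstates I s a = nfa_step (aut I (chan a)) (nstates s (chan a)) (letter a)"

text \<open>Only a receive moves an automaton, so only a receive has to check that the received word
  can still be completed.\<close>

definition enabled :: "fifo \<times> nfa list \<Rightarrow> pstate \<Rightarrow> transition \<Rightarrow> bool" where
  "enabled I s d \<longleftrightarrow> src d = fst s \<and> (is_send (act d) \<or>
     (case content s (chan (act d)) of [] \<Rightarrow> False | y # _ \<Rightarrow> y = letter (act d))
     \<and> viable (aut I (chan (act d))) (next_nstates I s (act d)))"

definition fire :: "fifo \<times> nfa list \<Rightarrow> pstate \<Rightarrow> transition \<Rightarrow> pstate" where
  "fire I s d = (tgt d,
     if is_send (act d)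
     then ((fst (snd s))[chan (act d) := content s (chan (act d)) @ [letter (act d)]], snd (snd s))
     else ((fst (snd s))[chan (act d) := tl (content s (chan (act d)))],
           (snd (snd s))[chan (act d) := next_nstates I s (act d)]))"

definition run :: "fifo \<times> nfa list \<Rightarrow> pstate \<Rightarrow> transition list \<Rightarrow> pstate" where
  "run I s \<pi> = foldl (fire I) s \<pi>"

definition ok :: "fifo \<times> nfa list \<Rightarrow> pstate \<Rightarrow> transition list \<Rightarrow> bool" where
  "ok I s \<pi> \<longleftrightarrow> (\<forall>i<length \<pi>. enabled I (run I s (take i \<pi>)) (nth_or undefined \<pi> i))"

text \<open>The content \<^term>\<open>w\<close> has grown to \<^term>\<open>w'\<close> while the word \<^term>\<open>v\<close> was sent. Commutation makes
  the loop repeatable: if \<^term>\<open>w' = w @ t\<close> and \<^term>\<open>t @ v = v @ t\<close>, then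
  \<^term>\<open>w' @ v = (w @ v) @ t\<close>, so what could be received from \<^term>\<open>w @ v\<close> can be received again.\<close>

definition growth :: "nat list \<Rightarrow> nat list \<Rightarrow> nat list \<Rightarrow> bool" where
  "growth w w' v \<longleftrightarrow> w' = w @ drop (length w) w' \<and> drop (length w) w' @ v = v @ drop (length w) w'"

definition pump :: "fifo \<times> nfa list \<Rightarrow> transition list \<Rightarrow> nat \<Rightarrow> nat \<Rightarrow> bool" where
  "pump I \<pi> i j \<longleftrightarrow>
     fst (run I (start I) (take i \<pi>)) = fst (run I (start I) (take j \<pi>))
   \<and> snd (snd (run I (start I) (take i \<pi>))) = snd (snd (run I (start I) (take j \<pi>)))
   \<and> (\<forall>c<nch (fst I). growth (content (run I (start I) (take i \<pi>)) c)
        (content (run I (start I) (take j \<pi>)) c) (sends c (drop i (take j \<pi>))))"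

definition paths :: "fifo \<times> nfa list \<Rightarrow> nat \<Rightarrow> transition list list" where
  "paths I n = rec_nat [[]] (\<lambda>_ ps. concat (map (\<lambda>d. map (\<lambda>\<pi>. d # \<pi>) ps) (delta (fst I)))) n"

text \<open>The bound \<open>Suc n\<close> admits \<open>j = n\<close>, the end of the path. If
  there is no run of length \<open>n\<close> the condition holds vacuously, so the search also ends
  on instances all of whose runs are short.\<close>

definition settled :: "fifo \<times> nfa list \<Rightarrow> nat \<Rightarrow> bool" where
  "settled I n \<longleftrightarrow> (\<forall>\<pi>\<in>set (paths I n). ok I (start I) \<pi> \<longrightarrow> (\<exists>j<Suc n. \<exists>i<j. pump I \<pi> i j))"

definition dead :: "fifo \<times> nfa list \<Rightarrow> nat \<Rightarrow> bool" where
  "dead I n \<longleftrightarrow> (\<forall>\<pi>\<in>set (paths I n). \<not> ok I (start I) \<pi>)"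

definition growing :: "fifo \<times> nfa list \<Rightarrow> nat \<Rightarrow> bool" where
  "growing I n \<longleftrightarrow> (\<exists>\<pi>\<in>set (paths I n). ok I (start I) \<pi> \<and> (\<exists>j<Suc n. \<exists>i<j. pump I \<pi> i j
     \<and> \<not> run I (start I) (take i \<pi>) = run I (start I) (take j \<pi>)))"

section \<open>Computability of the product\<close>

abbreviation "words_enc \<equiv> list_enc (list_enc nat_enc)"
abbreviation "pstate_enc \<equiv> prod_enc nat_enc (prod_enc words_enc words_enc)"
abbreviation "inst_enc \<equiv> prod_enc enc_fifo (list_enc enc_nfa)"

definition arc_enc :: "nat \<times> nat \<times> nat \<Rightarrow> nat" where
  "arc_enc t = list_encode [arc_src t, arc_letter t, arc_tgt t]"

lemma enc_instance_eq: "enc_instance = inst_enc"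
  by (rule ext) (simp add: enc_instance_def prod_enc_def list_enc_def split: prod.split)

text \<open>The code of an action is also the code of a nested triple whose first entry marks the
  constructor, so the fields are projections.\<close>

lemma computable_act_fields:
  "computable enc_act bool_enc is_send" "computable enc_act nat_enc chan"
  "computable enc_act nat_enc letter"
proof -
  let ?t = "\<lambda>a. (if is_send a then 0 else 1 :: nat, chan a, letter a)"
  have "prod_enc nat_enc (prod_enc nat_enc nat_enc) (?t a) = enc_act a" for a
    by (cases a) (simp_all add: prod_enc_def)
  then have t: "computable enc_act (prod_enc nat_enc (prod_enc nat_enc nat_enc)) ?t"
    by (rule computable_cong_code[OF computable_id])
  show "computable enc_act nat_enc chan"
    using computable_fst[OF computable_snd[OF t]] by simp
  show "computable enc_act nat_enc letter"
    using computable_snd[OF computable_snd[OF t]] by simp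
  have "computable enc_act bool_enc (\<lambda>a. fst (?t a) = 0)"
    by (rule computable_eq[OF computable_fst[OF t] computable_const inj_nat_enc])
  then show "computable enc_act bool_enc is_send"
    by (rule computable_cong_code) simp
qed

lemmas [computable_intros] =
  computable_act_fields[THEN computable_comp]

text \<open>Transitions, arcs, automata and machines are coded as fixed-length lists of field codes.
  Read as lists of plain numbers they give each field by position; the selected number already is
  the code of the field.\<close>

lemma computable_nth_code:
  assumes "computable e (list_enc nat_enc) xs" "\<And>x. length (xs x) > i"
  shows "computable e nat_enc (\<lambda>x. xs x ! i)"
  by (rule computable_cong_code[OF computable_nth_or[where c = 0, OF computable_const[of _ _ i] assms(1)]])
    (simp add: assms(2))

lemma computable_transition_fields:
  "computable enc_trans nat_enc src" "computable enc_trans enc_act act" "computable enc_trans nat_enc tgt"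
proof -
  let ?t = "\<lambda>d. [src d, enc_act (act d), tgt d]"
  have "list_enc nat_enc (?t d) = enc_trans d" for d
    by (cases d rule: enc_trans.cases) (simp add: list_enc_def src_def act_def tgt_def)
  then have t: "computable enc_trans (list_enc nat_enc) ?t"
    by (rule computable_cong_code[OF computable_id])
  show "computable enc_trans nat_enc src" "computable enc_trans enc_act act" "computable enc_trans nat_enc tgt"
    using computable_nth_code[OF t, of 0] computable_nth_code[OF t, of 1] computable_nth_code[OF t, of 2]
    by (simp_all add: computable_of_code)
qed

lemmas [computable_intros] =
  computable_transition_fields[THEN computable_comp]

lemma computable_arc_fields:
  "computable arc_enc nat_enc arc_src" "computable arc_enc nat_enc arc_letter" "computable arc_enc nat_enc arc_tgt"
proof -
  let ?t = "\<lambda>t. [arc_src t, arc_letter t, arc_tgt t]"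
  have "list_enc nat_enc (?t d) = arc_enc d" for d
    by (simp add: list_enc_def arc_enc_def)
  then have t: "computable arc_enc (list_enc nat_enc) ?t"
    by (rule computable_cong_code[OF computable_id])
  show "computable arc_enc nat_enc arc_src" "computable arc_enc nat_enc arc_letter" "computable arc_enc nat_enc arc_tgt"
    using computable_nth_code[OF t, of 0] computable_nth_code[OF t, of 1] computable_nth_code[OF t, of 2]
    by simp_all
qed

lemmas [computable_intros] =
  computable_arc_fields[THEN computable_comp]

lemma computable_nfa_fields:
  "computable enc_nfa (list_enc nat_enc) n_init" "computable enc_nfa (list_enc nat_enc) n_final"
  "computable enc_nfa (list_enc arc_enc) n_trans"
proof -
  let ?t = "\<lambda>A. [list_enc nat_enc (n_init A), list_enc nat_enc (n_final A), list_enc arc_enc (n_trans A)]"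
  have "(\<lambda>(p, x, q). list_encode [p, x, q]) = arc_enc"
    by (auto simp: fun_eq_iff arc_enc_def arc_src_def arc_letter_def arc_tgt_def)
  then have "list_enc nat_enc (?t A) = enc_nfa A" for A
    by (simp add: list_enc_def enc_nfa_def)
  then have t: "computable enc_nfa (list_enc nat_enc) ?t"
    by (rule computable_cong_code[OF computable_id])
  show "computable enc_nfa (list_enc nat_enc) n_init" "computable enc_nfa (list_enc nat_enc) n_final"
    "computable enc_nfa (list_enc arc_enc) n_trans"
    using computable_nth_code[OF t, of 0] computable_nth_code[OF t, of 1] computable_nth_code[OF t, of 2]
    by (simp_all add: computable_of_code)
qed

lemmas [computable_intros] =
  computable_nfa_fields[THEN computable_comp]

lemma computable_fifo_fields:
  "computable enc_fifo nat_enc nch" "computable enc_fifo (list_enc enc_trans) delta"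
  "computable enc_fifo nat_enc q0"
proof -
  let ?t = "\<lambda>M. [list_encode (states M), nch M, list_encode (map list_encode (sigma M)),
      list_enc enc_trans (delta M), q0 M]"
  have "list_enc nat_enc (?t M) = enc_fifo M" for M
    by (simp add: list_enc_def enc_fifo_def)
  then have t: "computable enc_fifo (list_enc nat_enc) ?t"
    by (rule computable_cong_code[OF computable_id])
  show "computable enc_fifo nat_enc nch" "computable enc_fifo (list_enc enc_trans) delta"
    "computable enc_fifo nat_enc q0"
    using computable_nth_code[OF t, of 1] computable_nth_code[OF t, of 3] computable_nth_code[OF t, of 4]
    by (simp_all add: computable_of_code)
qed

lemmas [computable_intros] =
  computable_fifo_fields[THEN computable_comp]

lemma computable_sends: "computable (prod_enc nat_enc (list_enc enc_trans)) (list_enc nat_enc)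
    (\<lambda>p. sends (fst p) (snd p))"
  unfolding sends_def by (rule computable_intros)+

lemmas [computable_intros] = computable_app2[OF computable_sends]

lemma computable_nfa_step: "computable (prod_enc enc_nfa (prod_enc (list_enc nat_enc) nat_enc)) (list_enc nat_enc)
    (\<lambda>p. nfa_step (fst p) (fst (snd p)) (snd (snd p)))"
  unfolding nfa_step_def by (rule computable_intros)+

lemmas [computable_intros] = computable_app3[OF computable_nfa_step]

lemma computable_coreach: "computable enc_nfa (list_enc nat_enc) coreach"
  unfolding coreach_def coreach_upto_def by (rule computable_intros)+

lemmas [computable_intros] = computable_coreach[THEN computable_comp]

lemma computable_viable: "computable (prod_enc enc_nfa (list_enc nat_enc)) bool_enc
    (\<lambda>p. viable (fst p) (snd p))"
  unfolding viable_def by (rule computable_intros)+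

lemmas [computable_intros] = computable_app2[OF computable_viable]

lemma computable_aut: "computable (prod_enc inst_enc nat_enc) enc_nfa (\<lambda>p. aut (fst p) (snd p))"
  unfolding aut_def by (rule computable_intros)+

lemmas [computable_intros] = computable_app2[OF computable_aut]

lemma computable_content:
  "computable (prod_enc pstate_enc nat_enc) (list_enc nat_enc) (\<lambda>p. content (fst p) (snd p))"
  unfolding content_def by (rule computable_intros)+

lemmas [computable_intros] = computable_app2[OF computable_content]

lemma computable_nstates:
  "computable (prod_enc pstate_enc nat_enc) (list_enc nat_enc) (\<lambda>p. nstates (fst p) (snd p))"
  unfolding nstates_def by (rule computable_intros)+

lemmas [computable_intros] = computable_app2[OF computable_nstates]

lemma computable_start: "computable inst_enc pstate_enc start"
  unfolding start_def by (rule computable_intros)+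

lemmas [computable_intros] = computable_start[THEN computable_comp]

lemma computable_next_nstates:
  "computable (prod_enc inst_enc (prod_enc pstate_enc enc_act)) (list_enc nat_enc)
    (\<lambda>p. next_nstates (fst p) (fst (snd p)) (snd (snd p)))"
  unfolding next_nstates_def by (rule computable_intros)+

lemmas [computable_intros] = computable_app3[OF computable_next_nstates]

lemma computable_enabled:
  "computable (prod_enc inst_enc (prod_enc pstate_enc enc_trans)) bool_enc
    (\<lambda>p. enabled (fst p) (fst (snd p)) (snd (snd p)))"
  unfolding enabled_def by (rule computable_intros)+

lemmas [computable_intros] = computable_app3[OF computable_enabled]

lemma computable_fire:
  "computable (prod_enc inst_enc (prod_enc pstate_enc enc_trans)) pstate_enc
    (\<lambda>p. fire (fst p) (fst (snd p)) (snd (snd p)))"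
  unfolding fire_def by (rule computable_intros)+

lemmas [computable_intros] = computable_app3[OF computable_fire]

lemma computable_run:
  "computable (prod_enc inst_enc (prod_enc pstate_enc (list_enc enc_trans))) pstate_enc
    (\<lambda>p. run (fst p) (fst (snd p)) (snd (snd p)))"
  unfolding run_def by (rule computable_intros)+

lemmas [computable_intros] = computable_app3[OF computable_run]

lemma computable_ok:
  "computable (prod_enc inst_enc (prod_enc pstate_enc (list_enc enc_trans))) bool_enc
    (\<lambda>p. ok (fst p) (fst (snd p)) (snd (snd p)))"
  unfolding ok_def by (rule computable_intros)+

lemmas [computable_intros] = computable_app3[OF computable_ok]

lemma computable_growth:
  "computable (prod_enc (list_enc nat_enc) (prod_enc (list_enc nat_enc) (list_enc nat_enc))) bool_enc
    (\<lambda>p. growth (fst p) (fst (snd p)) (snd (snd p)))"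
  unfolding growth_def by (rule computable_intros)+

lemmas [computable_intros] = computable_app3[OF computable_growth]

lemma computable_pump:
  "computable (prod_enc inst_enc (prod_enc (list_enc enc_trans) (prod_enc nat_enc nat_enc))) bool_enc
    (\<lambda>p. pump (fst p) (fst (snd p)) (fst (snd (snd p))) (snd (snd (snd p))))"
  unfolding pump_def by (rule computable_intros)+

lemmas [computable_intros] = computable_app4[OF computable_pump]

lemma computable_paths:
  "computable (prod_enc inst_enc nat_enc) (list_enc (list_enc enc_trans)) (\<lambda>p. paths (fst p) (snd p))"
  unfolding paths_def by (rule computable_intros)+

lemmas [computable_intros] = computable_app2[OF computable_paths]

lemma computable_settled:
  "computable (prod_enc inst_enc nat_enc) bool_enc (\<lambda>p. settled (fst p) (snd p))"
  unfolding settled_def by (rule computable_intros)+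

lemma computable_dead:
  "computable (prod_enc inst_enc nat_enc) bool_enc (\<lambda>p. dead (fst p) (snd p))"
  unfolding dead_def by (rule computable_intros)+

lemma computable_growing:
  "computable (prod_enc inst_enc nat_enc) bool_enc (\<lambda>p. growing (fst p) (snd p))"
  unfolding growing_def by (rule computable_intros)+

section \<open>Infinite words and bounded expressions\<close>

lemma bounded_expr_ConsD:
  assumes "u \<in> bounded_expr (w # ws)"
  obtains k v where "u = concat (replicate k w) @ v" "v \<in> bounded_expr ws"
proof -
  obtain us where us: "u = concat us" "length us = Suc (length ws)"
    "\<forall>i<Suc (length ws). \<exists>k. us ! i = concat (replicate k ((w # ws) ! i))"
    using assms unfolding bounded_expr_def by auto
  then obtain u0 us' where us': "us = u0 # us'" by (cases us) auto
  obtain k where "u0 = concat (replicate k w)" using us(3) us' by force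
  moreover have "\<forall>i<length ws. \<exists>k. us' ! i = concat (replicate k (ws ! i))"
    using us(3) unfolding us' by (metis Suc_less_eq nth_Cons_Suc)
  then have "concat us' \<in> bounded_expr ws"
    using us(2) unfolding us' bounded_expr_def by auto
  ultimately show ?thesis using that us(1) us' by simp
qed

lemma nth_concat_replicate:
  "i < k * length w \<Longrightarrow> concat (replicate k w) ! i = w ! (i mod length w)"
proof (induction k arbitrary: i)
  case (Suc k)
  show ?case
  proof (cases "i < length w")
    case False
    then have "i - length w < k * length w" using Suc.prems by auto
    with Suc.IH[OF this] False show ?thesis
      by (simp add: nth_append le_mod_geq)
  qed (simp add: nth_append)
qed simp

lemma Pref_prefix: "v \<in> Pref L \<Longrightarrow> prefix u v \<Longrightarrow> u \<in> Pref L"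
  unfolding Pref_def by (auto elim!: prefixE)

lemma prefix_map_upt: "m \<le> n \<Longrightarrow> prefix (map f [0..<m]) (map f [0..<n])"
  by (metis le_add_diff_inverse map_append prefixI upt_add_eq_append zero_le)

lemma map_upt_shift: "map f [k..<k + n] = map (\<lambda>i. f (i + k)) [0..<n]"
  by (simp add: list_eq_iff_nth_eq add.commute)

text \<open>Either every prefix of \<open>\<rho>\<close> fits into a power of the first word
  \<open>w\<close>, and \<open>\<rho>\<close> repeats \<open>w\<close> forever; or the initial power
  of \<open>w\<close> ends within a bounded distance, and a tail of \<open>\<rho>\<close> is bounded
  by the remaining words.\<close>

lemma eventually_periodic:
  assumes "\<forall>w\<in>set ws. w \<noteq> []" and "\<And>n. map \<rho> [0..<n] \<in> Pref (bounded_expr ws)"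
  shows "\<exists>N p. p > 0 \<and> (\<forall>n\<ge>N. \<rho> (n + p) = \<rho> n)"
  using assms
proof (induction ws arbitrary: \<rho>)
  case Nil
  \<comment> \<open>A prefix of length one does not fit into the empty product, so the case is
    void.\<close>
  from Nil.prems(2)[of 1] show ?case by (auto simp: Pref_def bounded_expr_def)
next
  case (Cons w ws)
  let ?p = "length w"
  have p: "?p > 0" using Cons.prems(1) by simp
  show ?case
  proof (cases "\<forall>n. \<exists>k. prefix (map \<rho> [0..<n]) (concat (replicate k w))")
    case True
    have "\<rho> n = w ! (n mod ?p)" for n
    proof -
      obtain k where "prefix (map \<rho> [0..<Suc n]) (concat (replicate k w))" using True by blast
      then obtain v where v: "concat (replicate k w) = map \<rho> [0..<Suc n] @ v" by (rule prefixE)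
      then have "length (concat (replicate k w)) > n" by simp
      then have "n < k * ?p" by (simp add: length_concat sum_list_replicate)
      moreover have "concat (replicate k w) ! n = \<rho> n" unfolding v by (simp add: nth_append)
      ultimately show ?thesis using nth_concat_replicate[of n k w] by simp
    qed
    then have "\<forall>n\<ge>0. \<rho> (n + ?p) = \<rho> n" by simp
    with p show ?thesis by blast
  next
    case False
    then obtain n0 where n0: "\<And>k. \<not> prefix (map \<rho> [0..<n0]) (concat (replicate k w))" by blast
    \<comment> \<open>A power of \<open>w\<close> reaching position \<open>n0\<close> would contain
      the prefix that fits into no power; so the exponent is below \<open>n0\<close>.\<close>
    have "\<exists>k<n0. k * ?p \<le> n \<and> map \<rho> [k * ?p..<n] \<in> Pref (bounded_expr ws)" if "n \<ge> n0" for n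
    proof -
      from Cons.prems(2)[of n] obtain x where "map \<rho> [0..<n] @ x \<in> bounded_expr (w # ws)"
        unfolding Pref_def by blast
      then obtain k v where kv: "map \<rho> [0..<n] @ x = concat (replicate k w) @ v" "v \<in> bounded_expr ws"
        by (rule bounded_expr_ConsD)
      have len: "length (concat (replicate k w)) = k * ?p"
        by (simp add: length_concat sum_list_replicate)
      have less: "k * ?p < n0"
      proof (rule ccontr)
        assume "\<not> k * ?p < n0"
        then have "take n0 (map \<rho> [0..<n] @ x) = take n0 (concat (replicate k w))"
          using kv(1) len by simp
        moreover have "take n0 (map \<rho> [0..<n] @ x) = map \<rho> [0..<n0]"
          using that by (simp add: take_map)
        ultimately show False using n0[of k] take_is_prefix by metis
      qed
      with that have le: "k * ?p \<le> n" by simp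
      have "v = drop (k * ?p) (map \<rho> [0..<n] @ x)" using kv(1) len by simp
      also have "\<dots> = map \<rho> [k * ?p..<n] @ x" using le by (simp add: drop_map)
      finally have "map \<rho> [k * ?p..<n] \<in> Pref (bounded_expr ws)"
        using kv(2) unfolding Pref_def by auto
      moreover have "k \<le> k * ?p" using p by (cases ?p) simp_all
      then have "k < n0" using less by linarith
      ultimately show ?thesis using le by blast
    qed
    then obtain K where K: "\<And>n. n \<ge> n0 \<Longrightarrow> K n < n0 \<and> K n * ?p \<le> n
        \<and> map \<rho> [K n * ?p..<n] \<in> Pref (bounded_expr ws)" by metis
    have "finite (K ` {n0..})" by (rule finite_subset[of _ "{..<n0}"]) (use K in auto)
    \<comment> \<open>One of the finitely many exponents serves infinitely many lengths; by closure
      under prefixes it then serves all lengths of the tail.\<close>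
    then obtain m where m: "infinite {n \<in> {n0..}. K n = K m}"
      using pigeonhole_infinite[of "{n0..}" K] infinite_Ici by blast
    let ?k = "K m * ?p"
    have "map (\<lambda>i. \<rho> (i + ?k)) [0..<n] \<in> Pref (bounded_expr ws)" for n
    proof -
      obtain n' where n': "n' > n + ?k" "n' \<ge> n0" "K n' = K m"
        using m unfolding infinite_nat_iff_unbounded by blast
      then have "map \<rho> [?k..<n'] \<in> Pref (bounded_expr ws)" using K[of n'] by simp
      moreover have "map \<rho> [?k..<n'] = map (\<lambda>i. \<rho> (i + ?k)) [0..<n' - ?k]"
        using map_upt_shift[of \<rho> ?k "n' - ?k"] n'(1) by simp
      moreover have "n \<le> n' - ?k" using n'(1) by simp
      ultimately show ?thesis using Pref_prefix prefix_map_upt by metis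
    qed
    with Cons.IH[of "\<lambda>i. \<rho> (i + ?k)"] Cons.prems(1) obtain N q
      where q: "q > 0" "\<forall>n\<ge>N. \<rho> (n + q + ?k) = \<rho> (n + ?k)" by auto
    have "\<rho> (n + q) = \<rho> n" if "n \<ge> N + ?k" for n
      using q(2)[rule_format, of "n - ?k"] that by simp
    with q(1) show ?thesis by blast
  qed
qed

section \<open>Subsequences\<close>

lemma constant_subseq:
  fixes f :: "nat \<Rightarrow> 'a"
  assumes "finite (range f)"
  shows "\<exists>r. strict_mono (r :: nat \<Rightarrow> nat) \<and> (\<forall>i j. f (r i) = f (r j))"
proof -
  obtain m where "infinite {n \<in> UNIV. f n = f m}"
    using pigeonhole_infinite[OF infinite_UNIV_nat assms] by blast
  then have inf: "infinite {n. f n = f m}" by simp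
  have "f (enumerate {n. f n = f m} i) = f m" for i
    using enumerate_in_set[OF inf, of i] by simp
  with strict_mono_enumerate[OF inf] show ?thesis by metis
qed

text \<open>Each chosen index minimizes \<open>f\<close> among all indices from it onwards, so every
  later choice has at least the same value.\<close>

lemma mono_subseq:
  fixes f :: "nat \<Rightarrow> nat"
  shows "\<exists>r. strict_mono (r :: nat \<Rightarrow> nat) \<and> (\<forall>i j. i \<le> j \<longrightarrow> f (r i) \<le> f (r j))"
proof -
  have ex: "\<exists>y>x. \<forall>k\<ge>y. f y \<le> f k" for x
  proof -
    define y where "y = arg_min f (\<lambda>y. y > x)"
    have "y > x \<and> (\<forall>k. k > x \<longrightarrow> f y \<le> f k)"
      unfolding y_def by (rule arg_min_nat_lemma[of _ "Suc x"]) simp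
    then show ?thesis by (intro exI[of _ y]) auto
  qed
  have "\<exists>r. \<forall>n. (\<forall>k\<ge>r n. f (r n) \<le> f k) \<and> r n < r (Suc n)"
    by (rule dependent_nat_choice) (use ex in blast)+
  then obtain r where r: "\<And>n k. k \<ge> r n \<Longrightarrow> f (r n) \<le> f k" "\<And>n. r n < r (Suc n)" by blast
  have "strict_mono r" using r(2) by (simp add: strict_mono_Suc_iff)
  moreover have "f (r i) \<le> f (r j)" if "i \<le> j" for i j
    using r(1) that \<open>strict_mono r\<close> by (simp add: strict_mono_less_eq)
  ultimately show ?thesis by blast
qed

text \<open>Quantifying over a given subsequence \<open>r\<close> allows several relations to be
  treated one after another; a single good pair for each relation would not combine into a common
  one.\<close>

definition subseq_closed :: "(nat \<Rightarrow> nat \<Rightarrow> bool) \<Rightarrow> bool" where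
  "subseq_closed G \<longleftrightarrow> (\<forall>r. strict_mono r \<longrightarrow>
     (\<exists>r'. strict_mono (r' :: nat \<Rightarrow> nat) \<and> (\<forall>i j. i < j \<longrightarrow> G (r (r' i)) (r (r' j)))))"

text \<open>The subsequence found for the first \<open>k\<close> relations is refined for the next
  one; a relation that holds for all pairs survives the thinning.\<close>

lemma subseq_closed_All_less:
  fixes k :: nat
  assumes "\<And>c. c < k \<Longrightarrow> subseq_closed (G c)"
  shows "subseq_closed (\<lambda>i j. \<forall>c<k. G c i j)"
  using assms
proof (induction k)
  case 0
  show ?case unfolding subseq_closed_def by (auto intro: strict_mono_Suc_iff[THEN iffD2])
next
  case (Suc k)
  show ?case unfolding subseq_closed_def
  proof (intro allI impI)
    fix r :: "nat \<Rightarrow> nat" assume r: "strict_mono r"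
    have "subseq_closed (\<lambda>i j. \<forall>c<k. G c i j)" by (rule Suc.IH) (simp add: Suc.prems)
    then obtain r1 :: "nat \<Rightarrow> nat" where r1: "strict_mono r1" "\<And>i j. i < j \<Longrightarrow> \<forall>c<k. G c (r (r1 i)) (r (r1 j))"
      using r unfolding subseq_closed_def by blast
    have "strict_mono (\<lambda>i. r (r1 i))" using r r1(1) by (simp add: strict_mono_def)
    then obtain r2 :: "nat \<Rightarrow> nat" where r2: "strict_mono r2" "\<And>i j. i < j \<Longrightarrow> G k (r (r1 (r2 i))) (r (r1 (r2 j)))"
      using Suc.prems[of k] unfolding subseq_closed_def by blast
    have "strict_mono (\<lambda>i. r1 (r2 i))" using r1(1) r2(1) by (simp add: strict_mono_def)
    moreover have "\<forall>c<Suc k. G c (r (r1 (r2 i))) (r (r1 (r2 j)))" if "i < j" for i j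
      using r1(2)[of "r2 i" "r2 j"] r2(2)[OF that] strict_monoD[OF r2(1) that]
      by (auto simp: less_Suc_eq)
    ultimately show "\<exists>r'. strict_mono (r' :: nat \<Rightarrow> nat) \<and> (\<forall>i j. i < j \<longrightarrow> (\<forall>c<Suc k. G c (r (r' i)) (r (r' j))))"
      by (intro exI[of _ "\<lambda>i. r1 (r2 i)"]) blast
  qed
qed

section \<open>Growth of a single channel\<close>

lemma growthI: "w' = w @ t \<Longrightarrow> t @ v = v @ t \<Longrightarrow> growth w w' v"
  by (simp add: growth_def)

lemma growthE:
  assumes "growth w w' v" obtains t where "w' = w @ t" "t @ v = v @ t"
  using assms unfolding growth_def by blast

lemma periodic_add:
  assumes "\<forall>n\<ge>N. \<rho> (n + p) = \<rho> n" and "n \<ge> N"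
  shows "\<rho> (n + p * k) = \<rho> (n::nat)"
proof (induction k)
  case (Suc k)
  have "\<rho> (n + p * k + p) = \<rho> (n + p * k)" using assms by simp
  with Suc show ?case by (simp add: ac_simps)
qed simp

lemma mod_eq_natE:
  assumes "(x::nat) mod n = y mod n" "y \<le> x"
  obtains q where "x = y + n * q"
proof -
  have "n dvd x - y" using assms mod_eq_dvd_iff_nat by blast
  then obtain q where "x - y = n * q" by (rule dvdE)
  with assms(2) show ?thesis using that[of q] by simp
qed

lemma periodic_upt:
  assumes "\<forall>n\<ge>N. \<rho> (n + p) = \<rho> n" and "a \<ge> N" "a \<le> a'" "a mod p = a' mod p"
  shows "map \<rho> [a'..<a' + m] = map \<rho> [a..<a + m]"
proof -
  obtain q where q: "a' = a + p * q" using mod_eq_natE[of a' p a] assms(3,4) by metis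
  show ?thesis
  proof (rule nth_equalityI)
    fix i assume "i < length (map \<rho> [a'..<a' + m])"
    then show "map \<rho> [a'..<a' + m] ! i = map \<rho> [a..<a + m] ! i"
      using periodic_add[OF assms(1), of "a + i" q] assms(2) by (simp add: q ac_simps)
  qed simp
qed

text \<open>Here \<open>a\<close>, \<open>b\<close> are the numbers of letters received and sent at
  the earlier position, \<open>a'\<close>, \<open>b'\<close> at the later one. As \<open>a\<close>
  and \<open>a'\<close> have the same phase, the later content starts with a copy of the earlier
  one. What follows can be read from \<open>b\<close>, like the sent word, and both lengths are
  multiples of \<open>p\<close>.\<close>

lemma growth_periodic:
  assumes per: "\<forall>n\<ge>N. \<rho> (n + p) = \<rho> n" and N: "N \<le> a"
    and le: "a \<le> b" "a' \<le> b'" "a \<le> a'" "b \<le> b'" "b - a \<le> b' - a'"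
    and cong: "a mod p = a' mod p" "b mod p = b' mod p"
  shows "growth (map \<rho> [a..<b]) (map \<rho> [a'..<b']) (map \<rho> [b..<b'])"
proof -
  \<comment> \<open>\<open>e\<close> is the end of the copy of the old content inside the new one,
    and \<open>l\<close> the length of the surplus.\<close>
  define e where "e = a' + (b - a)"
  define l where "l = b' - e"
  have e: "b \<le> e" "e \<le> b'" using le by (auto simp: e_def)
  have econg: "b mod p = e mod p"
  proof -
    obtain q where "a' = a + p * q" using mod_eq_natE[of a' p a] le(3) cong(1) by metis
    then show ?thesis using le(1) by (simp add: e_def)
  qed
  have "p dvd l" "p dvd b' - b"
    using econg cong(2) e le(4) unfolding l_def by (metis mod_eq_dvd_iff_nat)+
  then have "(b + l) mod p = b mod p" "(b + (b' - b)) mod p = b mod p" by auto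
  have "map \<rho> [a'..<b'] = map \<rho> [a'..<e] @ map \<rho> [e..<b']"
    using e le upt_add_eq_append[of a' e "b' - e"] by (simp add: e_def flip: map_append)
  moreover have "map \<rho> [a'..<e] = map \<rho> [a..<b]"
    using periodic_upt[OF per N le(3) cong(1), of "b - a"] le(1) by (simp add: e_def)
  moreover have t: "map \<rho> [e..<b'] = map \<rho> [b..<b + l]"
    using periodic_upt[OF per _ e(1) econg, of l] N le(1) e(2) by (simp add: l_def)
  ultimately have 1: "map \<rho> [a'..<b'] = map \<rho> [a..<b] @ map \<rho> [b..<b + l]" by simp
  \<comment> \<open>Both orders of concatenation spell the factor of \<open>\<rho>\<close> that
    starts at \<open>b\<close> and has length \<open>l + (b' - b)\<close>.\<close>
  have "map \<rho> [b..<b + l] @ map \<rho> [b..<b'] = map \<rho> [b..<b + l] @ map \<rho> [b + l..<b + l + (b' - b)]"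
    using periodic_upt[OF per, of b "b + l" "b' - b"] N le \<open>(b + l) mod p = b mod p\<close> by simp
  also have "\<dots> = map \<rho> [b..<b + (l + (b' - b))]"
    using upt_add_eq_append[of b "b + l" "b' - b"] by (simp add: ac_simps flip: map_append)
  also have "\<dots> = map \<rho> [b..<b'] @ map \<rho> [b'..<b' + l]"
    using upt_add_eq_append[of b b' l] le(4) by (simp add: ac_simps flip: map_append)
  also have "map \<rho> [b'..<b' + l] = map \<rho> [b..<b + l]"
    using periodic_upt[OF per, of b b' l] N le cong(2) by simp
  finally show ?thesis using 1 by (intro growthI[where t = "map \<rho> [b..<b + l]"])
qed

text \<open>\<open>sd i\<close> and \<open>rc i\<close> stand for the words sent and received in the
  first \<open>i\<close> steps; what is left of \<open>sd i\<close> after removing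
  \<open>rc i\<close> is the content.\<close>

lemma channel_growth:
  fixes sd rc :: "nat \<Rightarrow> nat list"
  assumes sd: "\<And>i j. i \<le> j \<Longrightarrow> prefix (sd i) (sd j)" and rc: "\<And>i j. i \<le> j \<Longrightarrow> prefix (rc i) (rc j)"
    and rcsd: "\<And>i. prefix (rc i) (sd i)"
    and ws: "\<forall>w\<in>set ws. w \<noteq> []" "\<And>i. rc i \<in> Pref (bounded_expr ws)"
  shows "subseq_closed (\<lambda>i j. growth (drop (length (rc i)) (sd i)) (drop (length (rc j)) (sd j))
    (drop (length (sd i)) (sd j)))"
  unfolding subseq_closed_def
proof (intro allI impI)
  fix r :: "nat \<Rightarrow> nat" assume r: "strict_mono r"
  let ?G = "\<lambda>i j. growth (drop (length (rc i)) (sd i)) (drop (length (rc j)) (sd j))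
    (drop (length (sd i)) (sd j))"
  show "\<exists>r'. strict_mono (r' :: nat \<Rightarrow> nat) \<and> (\<forall>i j. i < j \<longrightarrow> ?G (r (r' i)) (r (r' j)))"
  proof (cases "\<exists>B. \<forall>i. length (rc i) \<le> B")
    \<comment> \<open>Once the received word has become constant, the content grows by precisely
      what is sent, so the surplus is the sent word itself and commutes with it.\<close>
    case True
    then obtain B where B: "\<And>i. length (rc i) < Suc B" by (auto simp: less_Suc_eq_le)
    obtain N where N: "\<And>i. length (rc i) \<le> length (rc N)"
      using ex_has_greatest_nat[of "\<lambda>_. True" 0 "\<lambda>i. length (rc i)" "Suc B"] B by auto
    have const: "rc i = rc N" if "i \<ge> N" for i
      using rc[OF that] N[of i] by (auto elim!: prefixE)
    have "?G (r (i + N)) (r (j + N))" if "i < j" for i j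
    proof -
      have "N \<le> r (i + N)" "N \<le> r (j + N)" "r (i + N) \<le> r (j + N)"
        using strict_mono_imp_increasing[OF r] that r
        by (meson le_add2 le_trans, meson le_add2 le_trans, simp add: strict_mono_less_eq)
      then obtain z where z: "sd (r (j + N)) = sd (r (i + N)) @ z" and
        "rc (r (i + N)) = rc N" "rc (r (j + N)) = rc N"
        using sd const by (meson prefixE)
      moreover have "length (rc N) \<le> length (sd (r (i + N)))"
        using rcsd[of "r (i + N)"] \<open>rc (r (i + N)) = rc N\<close> prefix_length_le by metis
      ultimately show ?thesis by (intro growthI[where t = z]) simp_all
    qed
    moreover have "strict_mono (\<lambda>i. i + N)" by (simp add: strict_mono_def)
    ultimately show ?thesis by blast
  next
    case False
    then have unb: "\<exists>i. length (rc i) > B" for B by (meson not_le)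
    define \<rho> where "\<rho> n = rc (SOME i. length (rc i) > n) ! n" for n
    have nth_rc: "rc i ! n = \<rho> n" if "n < length (rc i)" for i n
    proof -
      let ?i = "SOME i. length (rc i) > n"
      have "n < length (rc ?i)" using that by (rule someI)
      moreover have "prefix (rc i) (rc ?i) \<or> prefix (rc ?i) (rc i)" using rc nat_le_linear by blast
      ultimately show ?thesis unfolding \<rho>_def using that by (auto elim!: prefixE simp: nth_append)
    qed
    \<comment> \<open>Received words outgrow every \<open>n\<close> and are prefixes of sent ones,
      so the letter sent at position \<open>n\<close> is eventually received; both kinds of words
      are prefixes of the same infinite word.\<close>
    have nth_sd: "sd i ! n = \<rho> n" if "n < length (sd i)" for i n
    proof -
      obtain k where k: "length (rc k) > n" using unb by blast
      let ?k = "max i k"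
      have "prefix (rc k) (rc ?k)" by (rule rc) simp
      then have "n < length (rc ?k)" using k prefix_length_le by (metis less_le_trans)
      moreover have "prefix (sd i) (sd ?k)" by (rule sd) simp
      ultimately have "sd i ! n = rc ?k ! n"
        using that rcsd[of ?k] by (auto elim!: prefixE simp: nth_append) (metis nth_append)
      then show ?thesis using nth_rc \<open>n < length (rc ?k)\<close> by metis
    qed
    have rc_eq: "rc i = map \<rho> [0..<length (rc i)]" and sd_eq: "sd i = map \<rho> [0..<length (sd i)]" for i
      by (rule nth_equalityI; simp add: nth_rc nth_sd)+
    have "map \<rho> [0..<n] \<in> Pref (bounded_expr ws)" for n
    proof -
      obtain i where "length (rc i) > n" using unb by blast
      then have "prefix (map \<rho> [0..<n]) (rc i)"
        using rc_eq[of i] prefix_map_upt by (metis less_imp_le)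
      then show ?thesis using ws(2) Pref_prefix by blast
    qed
    from eventually_periodic[OF ws(1) this] obtain N p
      where p: "p > 0" and per: "\<forall>n\<ge>N. \<rho> (n + p) = \<rho> n" by blast
    obtain K where K: "length (rc K) > N" using unb by blast
    \<comment> \<open>Three refinements meet the hypotheses of \<open>growth_periodic\<close>:
      constant residues of both lengths modulo \<open>p\<close>, non-decreasing content lengths, and
      a shift by \<open>K\<close> that moves the received length beyond the preperiod
      \<open>N\<close>.\<close>
    define f where "f i = (length (rc (r i)) mod p, length (sd (r i)) mod p)" for i
    have "finite (range f)"
      by (rule finite_subset[of _ "{..<p} \<times> {..<p}"]) (use p in \<open>auto simp: f_def\<close>)
    from constant_subseq[OF this] obtain r1 :: "nat \<Rightarrow> nat" where r1: "strict_mono r1" "\<And>i j. f (r1 i) = f (r1 j)" by blast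
    obtain r2 :: "nat \<Rightarrow> nat" where r2: "strict_mono r2"
      "\<And>i j. i \<le> j \<Longrightarrow> length (sd (r (r1 (r2 i)))) - length (rc (r (r1 (r2 i))))
         \<le> length (sd (r (r1 (r2 j)))) - length (rc (r (r1 (r2 j))))"
      using mono_subseq[of "\<lambda>i. length (sd (r (r1 i))) - length (rc (r (r1 i)))"] by blast
    let ?r = "\<lambda>i. r1 (r2 (i + K))"
    have sr: "strict_mono ?r" using r1(1) r2(1) by (simp add: strict_mono_def)
    have "?G (r (?r i)) (r (?r j))" if ij: "i < j" for i j
    proof -
      let ?i = "r (?r i)" and ?j = "r (?r j)"
      have le: "?i \<le> ?j" using strict_monoD[OF sr ij] r by (simp add: strict_mono_less_eq)
      have "strict_mono (\<lambda>i. r (r1 (r2 i)))" using r r1(1) r2(1) by (simp add: strict_mono_def)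
      then have "K \<le> ?i" using strict_mono_imp_increasing[of "\<lambda>i. r (r1 (r2 i))" "i + K"] by simp
      then have "N \<le> length (rc ?i)" using K rc[of K ?i] prefix_length_le by fastforce
      moreover have "length (rc ?i) \<le> length (sd ?i)" "length (rc ?j) \<le> length (sd ?j)"
        "length (rc ?i) \<le> length (rc ?j)" "length (sd ?i) \<le> length (sd ?j)"
        using rcsd rc[OF le] sd[OF le] by (simp_all add: prefix_length_le)
      moreover have "length (rc ?i) mod p = length (rc ?j) mod p" "length (sd ?i) mod p = length (sd ?j) mod p"
        using r1(2)[of "r2 (i + K)" "r2 (j + K)"] by (simp_all add: f_def)
      moreover have "length (sd ?i) - length (rc ?i) \<le> length (sd ?j) - length (rc ?j)"
        using r2(2)[of "i + K" "j + K"] ij by simp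
      ultimately have "growth (map \<rho> [length (rc ?i)..<length (sd ?i)]) (map \<rho> [length (rc ?j)..<length (sd ?j)])
          (map \<rho> [length (sd ?i)..<length (sd ?j)])"
        by (intro growth_periodic[OF per])
      moreover have "drop n (sd i) = map \<rho> [n..<length (sd i)]" for n i
        by (subst sd_eq) (simp add: drop_map)
      ultimately show ?thesis by simp
    qed
    with sr show ?thesis by (intro exI[of _ ?r]) blast
  qed
qed

section \<open>The automata tracking the received words\<close>

lemma runs_nfa_append: "runs_nfa A p (u @ v) q \<longleftrightarrow> (\<exists>r. runs_nfa A p u r \<and> runs_nfa A r v q)"
  by (induction u arbitrary: p) auto

lemma set_nfa_step: "set (nfa_step A S x) = {q. \<exists>p\<in>set S. (p, x, q) \<in> set (n_trans A)}"
  unfolding nfa_step_def arc_src_def arc_letter_def arc_tgt_def by force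

lemma set_foldl_nfa_step:
  "set (foldl (nfa_step A) S u) = {q. \<exists>p\<in>set S. runs_nfa A p u q}"
proof (induction u arbitrary: S)
  case (Cons x u)
  show ?case unfolding foldl_Cons Cons.IH set_nfa_step by auto
qed simp

lemma set_coreach_upto:
  "set (coreach_upto A n) = {q. \<exists>v. length v \<le> n \<and> (\<exists>f\<in>set (n_final A). runs_nfa A q v f)}"
proof (induction n)
  case 0
  show ?case by (auto simp: coreach_upto_def)
next
  case (Suc n)
  have unfold: "q \<in> set (coreach_upto A (Suc n)) \<longleftrightarrow>
      q \<in> set (coreach_upto A n) \<or> (\<exists>x q'. (q, x, q') \<in> set (n_trans A) \<and> q' \<in> set (coreach_upto A n))" for q
    unfolding coreach_upto_def by (force simp: arc_src_def arc_tgt_def)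
  have "q \<in> set (coreach_upto A (Suc n)) \<longleftrightarrow> (\<exists>v. length v \<le> Suc n \<and> (\<exists>f\<in>set (n_final A). runs_nfa A q v f))"
    (is "_ \<longleftrightarrow> ?r") for q
    unfolding unfold
  proof
    assume "q \<in> set (coreach_upto A n) \<or> (\<exists>x q'. (q, x, q') \<in> set (n_trans A) \<and> q' \<in> set (coreach_upto A n))"
    then show ?r
    proof
      assume "q \<in> set (coreach_upto A n)"
      then show ?r unfolding Suc.IH using le_SucI by blast
    next
      assume "\<exists>x q'. (q, x, q') \<in> set (n_trans A) \<and> q' \<in> set (coreach_upto A n)"
      then obtain x q' v f where "(q, x, q') \<in> set (n_trans A)" "length v \<le> n"
        "f \<in> set (n_final A)" "runs_nfa A q' v f"
        unfolding Suc.IH by blast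
      then show ?r by (intro exI[of _ "x # v"]) auto
    qed
  next
    assume ?r
    then obtain v f where v: "length v \<le> Suc n" "f \<in> set (n_final A)" "runs_nfa A q v f" by blast
    show "q \<in> set (coreach_upto A n) \<or> (\<exists>x q'. (q, x, q') \<in> set (n_trans A) \<and> q' \<in> set (coreach_upto A n))"
    proof (cases v)
      case Nil
      then have "length v \<le> n" by simp
      with v show ?thesis unfolding Suc.IH by blast
    next
      case (Cons x v')
      with v show ?thesis unfolding Suc.IH by auto
    qed
  qed
  then show ?case by blast
qed

text \<open>The iterates increase inside \<open>?S\<close> and are stationary as soon as two
  consecutive ones coincide, hence after at most \<open>card ?S\<close> rounds.\<close>

lemma set_coreach: "set (coreach A) = {q. \<exists>v. \<exists>f\<in>set (n_final A). runs_nfa A q v f}"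
proof -
  let ?C = "\<lambda>n. set (coreach_upto A n)"
  let ?S = "set (n_final A) \<union> arc_src ` set (n_trans A)"
  have step: "?C (Suc n) = ?C n \<union> {arc_src t | t. t \<in> set (n_trans A) \<and> arc_tgt t \<in> ?C n}" for n
    unfolding coreach_upto_def by auto
  have sub: "?C n \<subseteq> ?S" for n
    by (induction n) (auto simp: step, simp add: coreach_upto_def)
  have mono: "mono ?C" unfolding mono_iff_le_Suc step by blast
  have "?C (card ?S) = (\<Union>n. ?C n)"
  proof (rule finite_mono_strict_prefix_implies_finite_fixpoint[OF sub])
    show "\<exists>N. (\<forall>n\<le>N. \<forall>m\<le>N. m < n \<longrightarrow> ?C m \<subset> ?C n) \<and> (\<forall>n\<ge>N. ?C N = ?C n)"
      by (rule finite_mono_remains_stable_implies_strict_prefix)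
        (use mono sub step in \<open>auto intro: finite_subset[of _ "Pow ?S"]\<close>)
  qed simp
  moreover have "card ?S \<le> length (n_final A) + length (n_trans A)"
    by (intro order.trans[OF card_Un_le] add_mono card_length order.trans[OF card_image_le]) simp
  then have "?C (card ?S) \<subseteq> set (coreach A)"
    unfolding coreach_def by (rule monoD[OF mono])
  ultimately have "set (coreach A) = (\<Union>n. ?C n)" unfolding coreach_def by blast
  then show ?thesis unfolding set_coreach_upto by auto
qed

text \<open>Subset construction: whether a word can be completed to an accepted one depends only on
  the set of states it reaches, which makes the prefix condition decidable step by step.\<close>

lemma viable_iff: "viable A (foldl (nfa_step A) (n_init A) u) \<longleftrightarrow> u \<in> Pref (lang A)"
  unfolding viable_def set_coreach set_foldl_nfa_step Pref_def lang_def
  by (auto simp: runs_nfa_append)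

section \<open>Infinite branches of prefix-closed sets\<close>

text \<open>The branch is built from words with extensions of every length in \<open>Q\<close>;
  finiteness of \<open>A\<close> guarantees a successor of the same kind.\<close>

lemma koenig:
  assumes "finite A" and closed: "\<And>u v. Q (u @ v) \<Longrightarrow> Q u"
    and long: "\<And>n. \<exists>u. set u \<subseteq> A \<and> length u = n \<and> Q u"
  shows "\<exists>d :: nat \<Rightarrow> 'a. (\<forall>n. d n \<in> A) \<and> (\<forall>n. Q (map d [0..<n]))"
proof -
  define big where "big u \<longleftrightarrow> (\<forall>n. \<exists>v. set v \<subseteq> A \<and> length v = n \<and> Q (u @ v))" for u
  have step: "\<exists>a\<in>A. big (u @ [a])" if "big u" for u
  proof (rule ccontr)
    assume "\<not> (\<exists>a\<in>A. big (u @ [a]))"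
    then obtain N where N: "\<And>a v. a \<in> A \<Longrightarrow> set v \<subseteq> A \<Longrightarrow> length v = N a \<Longrightarrow> \<not> Q (u @ [a] @ v)"
      unfolding big_def by simp metis
    obtain B where B: "\<And>a. a \<in> A \<Longrightarrow> N a \<le> B"
      using finite_imageI[OF \<open>finite A\<close>, of N] Max_ge by (metis imageI)
    \<comment> \<open>If every letter \<open>a\<close> failed at some length \<open>N a\<close>, an
      extension longer than all of these would, after its first letter, contain a forbidden one by
      closure under prefixes.\<close>
    obtain v where v: "set v \<subseteq> A" "length v = Suc B" "Q (u @ v)"
      using \<open>big u\<close> unfolding big_def by blast
    then obtain a w where w: "v = a # w" "a \<in> A" "set w \<subseteq> A" "length w = B"
      by (cases v) auto
    have "Q (u @ [a] @ take (N a) w)"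
      using v(3) closed[of "u @ [a] @ take (N a) w" "drop (N a) w"] w(1) by simp
    moreover have "set (take (N a) w) \<subseteq> A" "length (take (N a) w) = N a"
      using w B[of a] set_take_subset[of "N a" w] by auto
    ultimately show False using N w(2) by blast
  qed
  have "\<exists>f. \<forall>n. big (f n) \<and> (\<exists>a\<in>A. f (Suc n) = f n @ [a]) \<and> (n = 0 \<longrightarrow> f n = [])"
  proof -
    have "\<exists>f. \<forall>n. (big (f n) \<and> (n = 0 \<longrightarrow> f n = [])) \<and> (\<exists>a\<in>A. f (Suc n) = f n @ [a])"
    proof (rule dependent_nat_choice)
      show "\<exists>x. big x \<and> (0 = (0::nat) \<longrightarrow> x = [])" using long by (auto simp: big_def)
      fix x and n :: nat assume "big x \<and> (n = 0 \<longrightarrow> x = [])"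
      with step show "\<exists>y. (big y \<and> (Suc n = 0 \<longrightarrow> y = [])) \<and> (\<exists>a\<in>A. y = x @ [a])" by blast
    qed
    then show ?thesis by blast
  qed
  then obtain f where f: "\<And>n. big (f n)" "\<And>n. \<exists>a\<in>A. f (Suc n) = f n @ [a]" "f 0 = []" by blast
  define d where "d n = last (f (Suc n))" for n
  have d: "d n \<in> A" "f (Suc n) = f n @ [d n]" for n
    using f(2)[of n] by (auto simp: d_def)
  have fd: "f n = map d [0..<n]" for n
    by (induction n) (simp_all add: f(3) d(2))
  have "Q (f n)" for n using f(1)[of n] closed unfolding big_def by blast
  with d fd show ?thesis by (intro exI[of _ d]) simp
qed

section \<open>Runs of the product of the machine and the automata\<close>

abbreviation receives :: "nat \<Rightarrow> transition list \<Rightarrow> nat list" where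
  "receives c \<pi> \<equiv> proj_recv c (map act \<pi>)"

lemma sends_Nil [simp]: "sends c [] = []"
  and sends_Cons: "sends c (d # \<pi>) =
    (if is_send (act d) \<and> chan (act d) = c then [letter (act d)] else []) @ sends c \<pi>"
  and sends_append: "sends c (\<pi> @ \<pi>') = sends c \<pi> @ sends c \<pi>'"
  by (simp_all add: sends_def)

lemma proj_recv_Nil [simp]: "proj_recv c [] = []"
  and proj_recv_Cons: "proj_recv c (a # \<sigma>) =
    (if \<not> is_send a \<and> chan a = c then [letter a] else []) @ proj_recv c \<sigma>"
  and proj_recv_append: "proj_recv c (\<sigma> @ \<sigma>') = proj_recv c \<sigma> @ proj_recv c \<sigma>'"
  by (cases a; simp add: proj_recv_def)+

lemma nth_or_Cons_Suc [simp]: "nth_or c (x # xs) (Suc i) = nth_or c xs i"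
  by (simp add: nth_or_def)

lemma run_Nil [simp]: "run I s [] = s"
  and run_Cons [simp]: "run I s (d # \<pi>) = run I (fire I s d) \<pi>"
  and run_append: "run I s (\<pi> @ \<pi>') = run I (run I s \<pi>) \<pi>'"
  by (simp_all add: run_def)

lemma ok_Nil [simp]: "ok I s []"
  by (simp add: ok_def)

lemma ok_Cons [simp]: "ok I s (d # \<pi>) \<longleftrightarrow> enabled I s d \<and> ok I (fire I s d) \<pi>"
  unfolding ok_def length_Cons All_less_Suc2 by simp

lemma ok_append: "ok I s (\<pi> @ \<pi>') \<longleftrightarrow> ok I s \<pi> \<and> ok I (run I s \<pi>) \<pi>'"
  by (induction \<pi> arbitrary: s) auto

lemma ok_take: "ok I s \<pi> \<Longrightarrow> ok I s (take n \<pi>)"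
  by (metis append_take_drop_id ok_append)

lemma set_paths: "set (paths I n) = {\<pi>. length \<pi> = n \<and> set \<pi> \<subseteq> set (delta (fst I))}"
proof (induction n)
  case (Suc n)
  have "set (paths I (Suc n)) = {d # \<pi> | d \<pi>. d \<in> set (delta (fst I)) \<and> \<pi> \<in> set (paths I n)}"
    unfolding paths_def by auto
  also have "\<dots> = {\<pi>. length \<pi> = Suc n \<and> set \<pi> \<subseteq> set (delta (fst I))}"
    unfolding Suc by (force simp: length_Suc_conv)
  finally show ?case .
qed (auto simp: paths_def)

definition cfg :: "pstate \<Rightarrow> config" where
  "cfg s = (fst s, fst (snd s))"

locale ob_instance =
  fixes M :: fifo and As :: "nfa list"
  assumes valid: "valid_instance (M, As)"
begin

abbreviation I where "I \<equiv> (M, As)"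

definition wfs :: "pstate \<Rightarrow> bool" where
  "wfs s \<longleftrightarrow> length (fst (snd s)) = nch M \<and> length (snd (snd s)) = nch M"

lemma len_As: "length As = nch M"
  using valid by (simp add: valid_instance_def)

lemma aut_eq: "c < nch M \<Longrightarrow> aut I c = As ! c"
  by (simp add: aut_def len_As)

lemma act_in_actions: "d \<in> set (delta M) \<Longrightarrow> act d \<in> actions M"
  using valid unfolding valid_instance_def wf_fifo_def act_def by (cases d) auto

lemma chan_less: "d \<in> set (delta M) \<Longrightarrow> chan (act d) < nch M"
  using act_in_actions[of d] by (auto simp: actions_def)

lemma wfs_start: "wfs (start I)"
  by (simp add: wfs_def start_def len_As)

lemma wfs_fire: "wfs s \<Longrightarrow> wfs (fire I s d)"
  by (simp add: wfs_def fire_def)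

lemma wfs_run: "wfs s \<Longrightarrow> wfs (run I s \<pi>)"
  by (induction \<pi> arbitrary: s) (simp_all add: wfs_fire)

lemma content_eq: "wfs s \<Longrightarrow> c < nch M \<Longrightarrow> content s c = fst (snd s) ! c"
  by (simp add: content_def wfs_def)

lemma nstates_eq: "wfs s \<Longrightarrow> c < nch M \<Longrightarrow> nstates s c = snd (snd s) ! c"
  by (simp add: nstates_def wfs_def)

lemma content_start: "c < nch M \<Longrightarrow> content (start I) c = []"
  by (simp add: content_eq wfs_start) (simp add: start_def)

lemma nstates_start: "c < nch M \<Longrightarrow> nstates (start I) c = n_init (aut I c)"
  by (simp add: nstates_eq wfs_start aut_eq) (simp add: start_def len_As)

lemma content_fire:
  assumes "wfs s" "c < nch M"
  shows "content (fire I s d) c = (if chan (act d) = c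
    then if is_send (act d) then content s c @ [letter (act d)] else tl (content s c) else content s c)"
  using assms by (simp add: content_eq wfs_fire) (simp add: fire_def content_eq wfs_def)

lemma nstates_fire:
  assumes "wfs s" "c < nch M"
  shows "nstates (fire I s d) c = (if chan (act d) = c \<and> \<not> is_send (act d)
    then nfa_step (aut I c) (nstates s c) (letter (act d)) else nstates s c)"
  using assms by (simp add: nstates_eq wfs_fire) (simp add: fire_def nstates_eq wfs_def next_nstates_def)

lemma enabled_receive:
  assumes "enabled I s d" "\<not> is_send (act d)"
  shows "content s (chan (act d)) = letter (act d) # tl (content s (chan (act d)))"
    and "viable (aut I (chan (act d))) (next_nstates I s (act d))"
  using assms unfolding enabled_def by (auto split: list.splits)

text \<open>Conservation law of a queue. From the initial state it makes the received word a prefix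
  of the sent word and the content their difference, the form that \<open>channel_growth\<close>
  works with.\<close>

lemma run_content:
  assumes "wfs s" "c < nch M" "ok I s \<pi>"
  shows "content s c @ sends c \<pi> = receives c \<pi> @ content (run I s \<pi>) c"
  using assms
proof (induction \<pi> arbitrary: s)
  case (Cons d \<pi>)
  then have "content (fire I s d) c @ sends c \<pi> = receives c \<pi> @ content (run I s (d # \<pi>)) c"
    using wfs_fire by simp
  moreover have "content s c @ sends c (d # \<pi>) =
      (if \<not> is_send (act d) \<and> chan (act d) = c then [letter (act d)] else []) @ content (fire I s d) c @ sends c \<pi>"
    using Cons.prems enabled_receive(1)[of s d]
    by (auto simp: content_fire sends_Cons)
  ultimately show ?case by (simp add: proj_recv_Cons)
qed simp

lemma run_nstates:
  assumes "wfs s" "c < nch M"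
  shows "nstates (run I s \<pi>) c = foldl (nfa_step (aut I c)) (nstates s c) (receives c \<pi>)"
  using assms
proof (induction \<pi> arbitrary: s)
  case (Cons d \<pi>)
  then show ?case using wfs_fire[of s d] by (simp add: nstates_fire proj_recv_Cons)
qed simp

lemma run_viable:
  assumes "wfs s" "c < nch M" "ok I s \<pi>" "viable (aut I c) (nstates s c)"
  shows "viable (aut I c) (nstates (run I s \<pi>) c)"
  using assms
proof (induction \<pi> arbitrary: s)
  case (Cons d \<pi>)
  have "viable (aut I c) (nstates (fire I s d) c)"
    using Cons.prems enabled_receive(2)[of s d] by (auto simp: nstates_fire next_nstates_def)
  with Cons show ?case using wfs_fire[of s d] by simp
qed simp

lemma receives_in_Pref:
  assumes "ok I (start I) \<pi>" "c < nch M"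
  shows "receives c \<pi> \<in> Pref (lang (As ! c))"
proof -
  \<comment> \<open>A non-empty language makes the empty word completable; this starts the
    invariant, since before the first receive on \<open>c\<close> nothing tests it.\<close>
  have "lang (As ! c) \<noteq> {}" using valid assms(2) by (auto simp: valid_instance_def)
  then have "[] \<in> Pref (lang (As ! c))" by (auto simp: Pref_def)
  then have "viable (aut I c) (nstates (start I) c)"
    using viable_iff[of "As ! c" "[]"] assms(2) by (simp add: nstates_start aut_eq)
  from run_viable[OF wfs_start assms(2,1) this] show ?thesis
    using viable_iff assms(2) by (simp add: run_nstates wfs_start nstates_start aut_eq)
qed

text \<open>\<open>Lq\<close> constrains labels and not executability, so the missing letters of
  each channel can simply be appended as receives; each projection sees only those of its own
  channel.\<close>

lemma in_Pref_Lq_iff: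
  "\<sigma> \<in> Pref (Lq M (map lang As)) \<longleftrightarrow>
     set \<sigma> \<subseteq> actions M \<and> (\<forall>c<nch M. proj_recv c \<sigma> \<in> Pref (lang (As ! c)))"
proof
  assume "\<sigma> \<in> Pref (Lq M (map lang As))"
  then show "set \<sigma> \<subseteq> actions M \<and> (\<forall>c<nch M. proj_recv c \<sigma> \<in> Pref (lang (As ! c)))"
    unfolding Pref_def Lq_def by (auto simp: proj_recv_append len_As)
next
  assume \<sigma>: "set \<sigma> \<subseteq> actions M \<and> (\<forall>c<nch M. proj_recv c \<sigma> \<in> Pref (lang (As ! c)))"
  then obtain x where x: "\<And>c. c < nch M \<Longrightarrow> proj_recv c \<sigma> @ x c \<in> lang (As ! c)"
    unfolding Pref_def by simp metis
  have letters: "set (x c) \<subseteq> set (sigma M ! c)" if "c < nch M" for c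
    using x[OF that] valid that unfolding valid_instance_def by fastforce
  let ?v = "\<lambda>n. concat (map (\<lambda>c. map (Recv c) (x c)) [0..<n])"
  have one: "proj_recv c (map (Recv c') y) = (if c = c' then y else [])" for c c' y
    by (induction y) (auto simp: proj_recv_Cons)
  have "proj_recv c (?v n) = (if c < n then x c else [])" for c n
    by (induction n) (auto simp: proj_recv_append one)
  moreover have "set (?v (nch M)) \<subseteq> actions M"
    using letters by (fastforce simp: actions_def)
  ultimately have "\<sigma> @ ?v (nch M) \<in> Lq M (map lang As)"
    using \<sigma> x unfolding Lq_def by (auto simp: proj_recv_append len_As)
  then show "\<sigma> \<in> Pref (Lq M (map lang As))" unfolding Pref_def by blast
qed

lemma ok_in_Pref_Lq:
  assumes "ok I (start I) \<pi>" "set \<pi> \<subseteq> set (delta M)"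
  shows "map act \<pi> \<in> Pref (Lq M (map lang As))"
  unfolding in_Pref_Lq_iff using receives_in_Pref[OF assms(1)] act_in_actions assms(2) by auto

lemma cfg_start: "cfg (start I) = init_config M"
  by (simp add: cfg_def start_def init_config_def map_replicate_const)

lemma step_fire:
  assumes "wfs s" "d \<in> set (delta M)" "enabled I s d"
  shows "step M (cfg s) (act d) (cfg (fire I s d))"
proof -
  obtain a where a: "act d = a" by simp
  have d: "(fst s, a, tgt d) \<in> set (delta M)"
    using assms(2,3) a unfolding enabled_def src_def act_def tgt_def by (metis prod.collapse)
  show ?thesis
  proof (cases a)
    case (Send c x)
    then show ?thesis
      using d a assms chan_less[OF assms(2)]
      by (simp add: cfg_def fire_def content_eq)
  next
    case (Recv c x)
    with a have "c < nch M" using chan_less[OF assms(2)] by simp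
    moreover have "content s c = x # tl (content s c)"
      using enabled_receive(1)[OF assms(3)] a Recv by simp
    then have "content s c \<noteq> []" "hd (content s c) = x" by (metis list.discI, metis list.sel(1))
    ultimately show ?thesis using d a Recv assms(1) by (simp add: cfg_def fire_def content_eq)
  qed
qed

lemma steps_run:
  assumes "wfs s" "set \<pi> \<subseteq> set (delta M)" "ok I s \<pi>"
  shows "steps M (cfg s) (map act \<pi>) (cfg (run I s \<pi>))"
  using assms
proof (induction \<pi> arbitrary: s)
  case (Cons d \<pi>)
  then have "steps M (cfg (fire I s d)) (map act \<pi>) (cfg (run I (fire I s d) \<pi>))"
    using wfs_fire[of s d] by simp
  moreover have "step M (cfg s) (act d) (cfg (fire I s d))"
    using Cons.prems by (intro step_fire) simp_all
  ultimately show ?case by (simp add: steps_cons)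
qed (simp add: steps_nil)

lemma fire_step:
  assumes "wfs s" "step M (cfg s) a t" and viable: "\<not> is_send a \<Longrightarrow> viable (aut I (chan a)) (next_nstates I s a)"
  obtains d where "d \<in> set (delta M)" "act d = a" "enabled I s d" "cfg (fire I s d) = t"
proof -
  obtain q' w' where t: "t = (q', w')" by (cases t)
  let ?d = "(fst s, a, q')"
  have d: "src ?d = fst s" "act ?d = a" "tgt ?d = q'" by (simp_all add: src_def act_def tgt_def)
  have "?d \<in> set (delta M) \<and> enabled I s ?d \<and> cfg (fire I s ?d) = t"
  proof (cases a)
    case (Send c x)
    then show ?thesis
      using assms d t by (simp add: cfg_def enabled_def fire_def content_eq)
  next
    case (Recv c x)
    with assms(2) t have h: "?d \<in> set (delta M)" "c < nch M" "fst (snd s) ! c \<noteq> []" "hd (fst (snd s) ! c) = x"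
      "w' = (fst (snd s))[c := tl (fst (snd s) ! c)]" by (simp_all add: cfg_def)
    then have "content s c = x # tl (content s c)" using assms(1) content_eq[of s c] by (metis list.collapse)
    then have "enabled I s ?d" using d Recv viable by (auto simp: enabled_def split: list.split)
    then show ?thesis using d h t Recv assms(1) by (simp add: cfg_def fire_def content_eq)
  qed
  then show ?thesis using that d(2) by blast
qed

text \<open>The automaton component is a function of the received words, so a label word lifts to
  the product once all its prefixes are viable. Phrasing this by a fold from
  \<open>nstates s c\<close> makes it pass to the tail of the word.\<close>

lemma run_steps:
  assumes "steps M (cfg s) \<sigma> t" "wfs s"
    and "\<And>u c. prefix u \<sigma> \<Longrightarrow> c < nch M \<Longrightarrow>
      viable (aut I c) (foldl (nfa_step (aut I c)) (nstates s c) (proj_recv c u))"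
  shows "\<exists>\<pi>. set \<pi> \<subseteq> set (delta M) \<and> map act \<pi> = \<sigma> \<and> ok I s \<pi> \<and> cfg (run I s \<pi>) = t"
  using assms
proof (induction "cfg s" \<sigma> t arbitrary: s rule: steps.induct)
  case (steps_nil)
  show ?case by (intro exI[of _ "[]"]) simp
next
  case (steps_cons a s' \<sigma> s'')
  have ch: "chan a < nch M" using steps_cons(1) by (cases a; cases s'; simp add: cfg_def)
  have "viable (aut I (chan a)) (next_nstates I s a)" if "\<not> is_send a"
    using steps_cons(5)[of "[a]" "chan a"] ch that by (simp add: proj_recv_Cons next_nstates_def)
  then obtain d where d: "d \<in> set (delta M)" "act d = a" "enabled I s d" "cfg (fire I s d) = s'"
    using fire_step[OF steps_cons(4,1)] by blast
  have "viable (aut I c) (foldl (nfa_step (aut I c)) (nstates (fire I s d) c) (proj_recv c u))"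
    if "prefix u \<sigma>" "c < nch M" for u c
    using steps_cons(5)[of "a # u" c] that steps_cons(4) d(2)
    by (auto simp: nstates_fire proj_recv_Cons split: if_splits)
  from steps_cons(3)[OF d(4)[symmetric] wfs_fire[OF steps_cons(4)] this]
  obtain \<pi> where "set \<pi> \<subseteq> set (delta M)" "map act \<pi> = \<sigma>" "ok I (fire I s d) \<pi>"
    "cfg (run I (fire I s d) \<pi>) = s''" by blast
  with d show ?case by (intro exI[of _ "d # \<pi>"]) simp
qed

lemma run_of_steps:
  assumes "steps M (init_config M) \<sigma> t" "\<sigma> \<in> Pref (Lq M (map lang As))"
  obtains \<pi> where "set \<pi> \<subseteq> set (delta M)" "map act \<pi> = \<sigma>" "ok I (start I) \<pi>" "cfg (run I (start I) \<pi>) = t"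
proof -
  have "viable (aut I c) (foldl (nfa_step (aut I c)) (nstates (start I) c) (proj_recv c u))"
    if "prefix u \<sigma>" "c < nch M" for u c
  proof -
    have "proj_recv c \<sigma> \<in> Pref (lang (As ! c))" using assms(2) that unfolding in_Pref_Lq_iff by blast
    then have "proj_recv c u \<in> Pref (lang (As ! c))"
      using that(1) by (auto elim!: prefixE Pref_prefix simp: proj_recv_append)
    then show ?thesis using that(2) viable_iff by (simp add: nstates_start aut_eq)
  qed
  with run_steps[of "start I" \<sigma> t] assms(1) wfs_start cfg_start show ?thesis using that by metis
qed

end

section \<open>Powers of a word\<close>

definition list_power :: "'a list \<Rightarrow> nat \<Rightarrow> 'a list" where
  "list_power u k = concat (replicate k u)"

lemma list_power_0 [simp]: "list_power u 0 = []"
  and list_power_Suc: "list_power u (Suc k) = u @ list_power u k"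
  by (simp_all add: list_power_def)

lemma list_power_Suc2: "list_power u (Suc k) = list_power u k @ u"
  by (induction k) (simp_all add: list_power_Suc)

lemma list_power_commute: "u @ v = v @ u \<Longrightarrow> list_power u k @ v = v @ list_power u k"
proof (induction k)
  case (Suc k)
  then show ?case by (simp add: list_power_Suc)
qed simp

lemma length_list_power: "length (list_power u k) = k * length u"
  by (induction k) (simp_all add: list_power_Suc)

lemma set_take_append_list_power: "set (take i \<pi> @ list_power (drop i (take j \<pi>)) k) \<subseteq> set \<pi>"
proof -
  have "set (drop i (take j \<pi>)) \<subseteq> set \<pi>" by (rule order.trans[OF set_drop_subset set_take_subset])
  then have "set (list_power (drop i (take j \<pi>)) k) \<subseteq> set \<pi>" by (auto simp only: list_power_def set_concat set_replicate_conv_if split: if_splits)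
  then show ?thesis using set_take_subset[of i \<pi>] by simp
qed

context ob_instance
begin

section \<open>Pumping\<close>

text \<open>The last assumption is an invariant of the simulation: along the run, the content of the second
  state followed by the letters still to be sent exceeds that of the first by \<^term>\<open>t c\<close>.\<close>

lemma run_shifted:
  assumes "wfs s" "wfs s'" "set \<rho> \<subseteq> set (delta M)" "ok I s \<rho>"
    and "fst s' = fst s" "snd (snd s') = snd (snd s)"
    and "\<And>c. c < nch M \<Longrightarrow> content s' c @ sends c \<rho> = content s c @ sends c \<rho> @ t c"
  shows "ok I s' \<rho>" "fst (run I s' \<rho>) = fst (run I s \<rho>)"
    and "snd (snd (run I s' \<rho>)) = snd (snd (run I s \<rho>))"
    and "\<And>c. c < nch M \<Longrightarrow> content (run I s' \<rho>) c = content (run I s \<rho>) c @ t c"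
proof -
  have "ok I s' \<rho> \<and> fst (run I s' \<rho>) = fst (run I s \<rho>)
    \<and> snd (snd (run I s' \<rho>)) = snd (snd (run I s \<rho>))
    \<and> (\<forall>c<nch M. content (run I s' \<rho>) c = content (run I s \<rho>) c @ t c)"
    using assms
  proof (induction \<rho> arbitrary: s s')
    case (Cons d \<rho>)
    let ?c = "chan (act d)"
    have c: "?c < nch M" using Cons.prems chan_less by simp
    have next_eq: "next_nstates I s' (act d) = next_nstates I s (act d)"
      using Cons.prems(6) by (simp add: next_nstates_def nstates_def)
    have recv: "content s' ?c = letter (act d) # tl (content s' ?c)"
      "tl (content s' ?c) @ sends ?c \<rho> = tl (content s ?c) @ sends ?c \<rho> @ t ?c" if r: "\<not> is_send (act d)"
    proof -
      obtain w where w: "content s ?c = letter (act d) # w"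
        using enabled_receive(1)[of s d] Cons.prems r by auto
      have eq: "content s' ?c @ sends ?c \<rho> = letter (act d) # w @ sends ?c \<rho> @ t ?c"
        using Cons.prems(7)[OF c] r w by (simp add: sends_Cons)
      \<comment> \<open>The leading letter on the left might stem from the pending sends instead of
        the content; counting lengths excludes an empty content.\<close>
      then have "length (content s' ?c @ sends ?c \<rho>) = Suc (length (w @ sends ?c \<rho> @ t ?c))" by simp
      then have "content s' ?c \<noteq> []" by auto
      then obtain y v where "content s' ?c = y # v" by (cases "content s' ?c") auto
      with eq w show "content s' ?c = letter (act d) # tl (content s' ?c)"
        "tl (content s' ?c) @ sends ?c \<rho> = tl (content s ?c) @ sends ?c \<rho> @ t ?c" by simp_all
    qed
    have en: "enabled I s' d"
    proof (cases "is_send (act d)")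
      case False
      have "(case content s' ?c of [] \<Rightarrow> False | y # _ \<Rightarrow> y = letter (act d))"
        by (subst recv(1)[OF False]) simp
      with Cons.prems False next_eq show ?thesis by (simp add: enabled_def)
    qed (use Cons.prems in \<open>simp add: enabled_def\<close>)
    have "content (fire I s' d) c @ sends c \<rho> = content (fire I s d) c @ sends c \<rho> @ t c" if "c < nch M" for c
      using Cons.prems(1,2) Cons.prems(7)[OF that] recv(2) that
      by (cases "chan (act d) = c"; cases "is_send (act d)") (auto simp: content_fire sends_Cons)
    moreover have "fst (fire I s' d) = fst (fire I s d)" "snd (snd (fire I s' d)) = snd (snd (fire I s d))"
      using Cons.prems(6) next_eq by (simp_all add: fire_def)
    ultimately have "ok I (fire I s' d) \<rho> \<and> fst (run I (fire I s' d) \<rho>) = fst (run I (fire I s d) \<rho>)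
      \<and> snd (snd (run I (fire I s' d) \<rho>)) = snd (snd (run I (fire I s d) \<rho>))
      \<and> (\<forall>c<nch M. content (run I (fire I s' d) \<rho>) c = content (run I (fire I s d) \<rho>) c @ t c)"
      using Cons.prems by (intro Cons.IH) (simp_all add: wfs_fire)
    with en show ?case by simp
  qed simp
  then show "ok I s' \<rho>" "fst (run I s' \<rho>) = fst (run I s \<rho>)"
    "snd (snd (run I s' \<rho>)) = snd (snd (run I s \<rho>))"
    "\<And>c. c < nch M \<Longrightarrow> content (run I s' \<rho>) c = content (run I s \<rho>) c @ t c" by blast+
qed

text \<open>After \<open>k\<close> rounds the surplus is \<open>list_power (t c) k\<close>. It
  commutes with what the loop sends because \<open>t c\<close> does, so \<open>run_shifted\<close>
  replays the loop and moves this surplus behind the \<open>t c\<close> gained in the new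
  round.\<close>

lemma pump_iterate:
  assumes \<pi>: "ok I (start I) \<pi>" "set \<pi> \<subseteq> set (delta M)" and ij: "i < j" and pump: "pump I \<pi> i j"
  obtains t where
    "\<And>k. ok I (start I) (take i \<pi> @ list_power (drop i (take j \<pi>)) k)"
    "\<And>k c. c < nch M \<Longrightarrow> content (run I (start I) (take i \<pi> @ list_power (drop i (take j \<pi>)) k)) c
       = content (run I (start I) (take i \<pi>)) c @ list_power (t c) k"
    "\<And>c. c < nch M \<Longrightarrow> content (run I (start I) (take j \<pi>)) c = content (run I (start I) (take i \<pi>)) c @ t c"
proof -
  define \<rho> where "\<rho> = drop i (take j \<pi>)"
  let ?s = "run I (start I) (take i \<pi>)"
  have split: "take j \<pi> = take i \<pi> @ \<rho>"
    unfolding \<rho>_def using ij by (metis append_take_drop_id less_imp_le min.absorb1 take_take)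
  have "ok I (start I) (take j \<pi>)"
    using \<pi>(1) by (rule ok_take)
  then have ok: "ok I (start I) (take i \<pi>)" "ok I ?s \<rho>"
    unfolding split ok_append by simp_all
  have run_j: "run I (start I) (take j \<pi>) = run I ?s \<rho>" unfolding split run_append by simp
  note p = pump[unfolded pump_def run_j, folded \<rho>_def]
  have "\<exists>t. content (run I ?s \<rho>) c = content ?s c @ t \<and> t @ sends c \<rho> = sends c \<rho> @ t" if "c < nch M" for c
    using p that growthE by (metis fst_conv)
  then obtain t where t: "\<And>c. c < nch M \<Longrightarrow> content (run I ?s \<rho>) c = content ?s c @ t c"
    "\<And>c. c < nch M \<Longrightarrow> t c @ sends c \<rho> = sends c \<rho> @ t c" by metis
  have sub: "set \<rho> \<subseteq> set (delta M)"
    unfolding \<rho>_def using \<pi>(2) set_drop_subset[of i "take j \<pi>"] set_take_subset[of j \<pi>] by blast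
  have wfs: "wfs (run I (start I) u)" for u by (rule wfs_run[OF wfs_start])
  have "ok I (start I) (take i \<pi> @ list_power \<rho> k)
    \<and> fst (run I (start I) (take i \<pi> @ list_power \<rho> k)) = fst ?s
    \<and> snd (snd (run I (start I) (take i \<pi> @ list_power \<rho> k))) = snd (snd ?s)
    \<and> (\<forall>c<nch M. content (run I (start I) (take i \<pi> @ list_power \<rho> k)) c = content ?s c @ list_power (t c) k)" for k
  proof (induction k)
    case 0
    show ?case using ok(1) by simp
  next
    case (Suc k)
    let ?u = "take i \<pi> @ list_power \<rho> k"
    let ?s' = "run I (start I) ?u"
    have comm: "content ?s' c @ sends c \<rho> = content ?s c @ sends c \<rho> @ list_power (t c) k" if "c < nch M" for c
      using Suc that list_power_commute[OF t(2)[OF that]] by simp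
    note sh = run_shifted[OF wfs wfs sub ok(2), of ?u "\<lambda>c. list_power (t c) k", OF _ _ comm]
    have eq: "take i \<pi> @ list_power \<rho> (Suc k) = ?u @ \<rho>" by (simp add: list_power_Suc2)
    show ?case
      unfolding eq run_append[of I "start I" ?u] ok_append[of I "start I" ?u]
      using Suc sh p by (simp add: t(1) list_power_Suc)
  qed
  with t(1) show ?thesis using that[of t] unfolding run_j \<rho>_def by blast
qed

section \<open>Every infinite run contains a pump\<close>

text \<open>The initial list enters separately because it is not produced by
  \<open>nfa_step\<close>; every other list is filtered from the arc targets, which bounds both its
  entries and its length.\<close>

definition nstates_range :: "nat list set" where
  "nstates_range = (\<Union>A\<in>set As. insert (n_init A)
     {ys. set ys \<subseteq> arc_tgt ` set (n_trans A) \<and> length ys \<le> length (n_trans A)})"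

lemma nstates_run_range: "set (snd (snd (run I (start I) \<pi>))) \<subseteq> nstates_range"
proof (induction \<pi> rule: rev_induct)
  case Nil
  show ?case by (auto simp: start_def nstates_range_def)
next
  case (snoc d \<pi>)
  let ?s = "run I (start I) \<pi>"
  have "nfa_step A S x \<in> nstates_range" if "A \<in> set As" for A S x
    using that unfolding nstates_range_def nfa_step_def
    by (auto intro!: order.trans[OF length_filter_le])
  moreover have "aut I (chan (act d)) \<in> set As" if "chan (act d) < nch M"
    using that by (simp add: aut_eq len_As)
  ultimately have "chan (act d) < nch M \<Longrightarrow> next_nstates I ?s (act d) \<in> nstates_range"
    unfolding next_nstates_def by blast
  \<comment> \<open>The transitions are arbitrary here, so the channel may be out of range; the
    update then changes nothing.\<close>
  moreover have "(snd (snd ?s))[n := x] = snd (snd ?s)" if "\<not> n < nch M" for n x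
    using that wfs_run[OF wfs_start, of \<pi>] by (simp add: wfs_def list_update_beyond)
  ultimately show ?case
    using snoc set_update_subset_insert[of "snd (snd ?s)" "chan (act d)" "next_nstates I ?s (act d)"]
    by (cases "chan (act d) < nch M") (auto simp: run_append fire_def)
qed

lemma finite_nstates_range: "finite nstates_range"
  unfolding nstates_range_def by (auto intro: finite_lists_length_le)

lemma infinite_run_pump:
  assumes d: "\<And>n. d n \<in> set (delta M)" and ok: "\<And>n. ok I (start I) (map d [0..<n])"
  shows "\<exists>i j. i < j \<and> pump I (map d [0..<j]) i j"
proof -
  let ?P = "\<lambda>n. map d [0..<n]"
  let ?s = "\<lambda>n. run I (start I) (?P n)"
  define f where "f n = (fst (?s n), snd (snd (?s n)))" for n
  have "fst (?s n) \<in> insert (q0 M) (tgt ` set (delta M))" for n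
    by (cases n) (use d in \<open>auto simp: run_append fire_def start_def\<close>)
  moreover have "snd (snd (?s n)) \<in> {D. set D \<subseteq> nstates_range \<and> length D = nch M}" for n
    using nstates_run_range wfs_run[OF wfs_start] by (simp add: wfs_def)
  ultimately have "range f \<subseteq> insert (q0 M) (tgt ` set (delta M)) \<times> {D. set D \<subseteq> nstates_range \<and> length D = nch M}"
    by (auto simp: f_def)
  then have "finite (range f)"
    by (rule finite_subset) (simp add: finite_lists_length_eq finite_nstates_range)
  from constant_subseq[OF this] obtain r0 :: "nat \<Rightarrow> nat"
    where r0: "strict_mono r0" "\<And>i j. f (r0 i) = f (r0 j)" by blast
  have pre: "map d [0..<j] = map d [0..<i] @ map d [i..<j]" if "i \<le> j" for i j
    using that by (metis le_add_diff_inverse map_append upt_add_eq_append zero_le)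
  let ?G = "\<lambda>c i j. growth (drop (length (receives c (?P i))) (sends c (?P i)))
      (drop (length (receives c (?P j))) (sends c (?P j))) (drop (length (sends c (?P i))) (sends c (?P j)))"
  have sr: "sends c (?P n) = receives c (?P n) @ content (?s n) c" if "c < nch M" for c n
    using run_content[OF wfs_start that ok] that by (simp add: content_start)
  have "subseq_closed (\<lambda>i j. \<forall>c<nch M. ?G c i j)"
  proof (rule subseq_closed_All_less)
    fix c assume c: "c < nch M"
    obtain ws where ws: "\<forall>w\<in>set ws. w \<noteq> []" "lang (As ! c) \<subseteq> bounded_expr ws"
      using valid c unfolding valid_instance_def bounded_lang_def prod.case by metis
    show "subseq_closed (?G c)"
    proof (rule channel_growth[OF _ _ _ ws(1)])
      show "prefix (sends c (?P i)) (sends c (?P j))" "prefix (receives c (?P i)) (receives c (?P j))"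
        if "i \<le> j" for i j
        unfolding pre[OF that] by (simp_all add: sends_append proj_recv_append)
      show "prefix (receives c (?P i)) (sends c (?P i))" for i
        unfolding sr[OF c] by simp
      show "receives c (?P i) \<in> Pref (bounded_expr ws)" for i
        using receives_in_Pref[OF ok c] ws(2) unfolding Pref_def by blast
    qed
  qed
  then obtain r :: "nat \<Rightarrow> nat" where r: "strict_mono r" "\<And>i j. i < j \<Longrightarrow> \<forall>c<nch M. ?G c (r0 (r i)) (r0 (r j))"
    using r0(1) unfolding subseq_closed_def by blast
  \<comment> \<open>Any two positions of the common subsequence would form a pump; the first two are
    taken.\<close>
  let ?i = "r0 (r 0)" and ?j = "r0 (r 1)"
  have ij: "?i < ?j" using r0(1) r(1) by (simp add: strict_mono_less)
  have "take ?i (?P ?j) = ?P ?i" "drop ?i (?P ?j) = map d [?i..<?j]"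
    using ij by (simp_all add: take_map drop_map)
  moreover have "growth (content (?s ?i) c) (content (?s ?j) c) (sends c (map d [?i..<?j]))" if "c < nch M" for c
  proof -
    have "drop (length (sends c (?P ?i))) (sends c (?P ?j)) = sends c (map d [?i..<?j])"
      unfolding pre[OF less_imp_le[OF ij]] by (simp add: sends_append)
    moreover have "?G c ?i ?j" using r(2)[OF zero_less_one] that by blast
    moreover have "drop (length (receives c (?P n))) (sends c (?P n)) = content (?s n) c" for n
      unfolding sr[OF that] by simp
    ultimately show ?thesis by simp
  qed
  moreover have "f ?i = f ?j" by (rule r0(2))
  ultimately have "pump I (?P ?j) ?i ?j" by (simp add: pump_def f_def)
  with ij show ?thesis by blast
qed

lemma pump_append: "j \<le> length \<pi> \<Longrightarrow> i < j \<Longrightarrow> pump I (\<pi> @ \<pi>') i j = pump I \<pi> i j"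
  by (simp add: pump_def)

lemma ex_settled: "\<exists>n. settled I n"
proof (rule ccontr)
  assume "\<not> (\<exists>n. settled I n)"
  \<comment> \<open>Absence of pumps is part of the predicate, and a pump depends only on the
    transitions up to \<open>j\<close>; so it passes to prefixes and holds along the whole branch
    given by \<open>koenig\<close>.\<close>
  let ?Q = "\<lambda>u. ok I (start I) u \<and> (\<forall>j\<le>length u. \<forall>i<j. \<not> pump I u i j)"
  have "\<exists>u. set u \<subseteq> set (delta M) \<and> length u = n \<and> ?Q u" for n
  proof -
    have "\<not> settled I n" using \<open>\<not> (\<exists>n. settled I n)\<close> by blast
    then show ?thesis unfolding settled_def set_paths by (auto simp: less_Suc_eq_le)
  qed
  moreover have "?Q u" if "?Q (u @ v)" for u v
    using that by (auto simp: ok_append) (metis le_add1 order.trans pump_append)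
  ultimately obtain d where d: "\<And>n. d n \<in> set (delta M)" "\<And>n. ?Q (map d [0..<n])"
    using koenig[of "set (delta M)" ?Q] by blast
  obtain i j where "i < j" "pump I (map d [0..<j]) i j"
    using infinite_run_pump d by blast
  moreover have "\<forall>i<j. \<not> pump I (map d [0..<j]) i j" using d(2)[of j] by simp
  ultimately show False by blast
qed

section \<open>Deciding termination and unboundedness\<close>

lemma terminating_iff:
  assumes "settled I n"
  shows "OB_terminating I \<longleftrightarrow> dead I n"
proof
  assume fin: "OB_terminating I"
  show "dead I n"
  proof (rule ccontr)
    assume "\<not> dead I n"
    then obtain \<pi> where \<pi>: "length \<pi> = n" "set \<pi> \<subseteq> set (delta M)" "ok I (start I) \<pi>"
      unfolding dead_def set_paths by auto
    then obtain i j where ij: "i < j" "j \<le> n" "pump I \<pi> i j"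
      using assms unfolding settled_def set_paths by (auto simp: less_Suc_eq_le)
    let ?\<rho> = "drop i (take j \<pi>)"
    have len: "length ?\<rho> > 0" using ij \<pi>(1) by simp
    have okk: "ok I (start I) (take i \<pi> @ list_power ?\<rho> k)" for k
      using pump_iterate[OF \<pi>(3,2) ij(1,3)] by blast
    have sub: "set (take i \<pi> @ list_power ?\<rho> k) \<subseteq> set (delta M)" for k
      using set_take_append_list_power \<pi>(2) by (rule order.trans)
    \<comment> \<open>Iterating the non-empty loop gives runs of every length, and
      \<open>koenig\<close> turns them into an infinite one, whichever branch it selects.\<close>
    let ?Q = "ok I (start I)"
    have "\<exists>u. set u \<subseteq> set (delta M) \<and> length u = m \<and> ?Q u" for m
    proof -
      let ?w = "take i \<pi> @ list_power ?\<rho> m"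
      have "m * 1 \<le> m * length ?\<rho>"
        by (rule mult_le_mono2) (use len in \<open>simp only: One_nat_def Suc_le_eq\<close>)
      then have "m \<le> length ?w" unfolding length_append length_list_power by linarith
      then have "length (take m ?w) = m" unfolding length_take by (rule min_absorb2)
      moreover have "?Q (take m ?w)"
        by (rule ok_take[OF okk])
      moreover have "set (take m ?w) \<subseteq> set (delta M)"
        using sub set_take_subset by (rule order.trans[rotated])
      ultimately show ?thesis by blast
    qed
    moreover have "?Q u" if "?Q (u @ v)" for u v using that by (simp add: ok_append)
    ultimately obtain d where d: "\<And>n. d n \<in> set (delta M)" "\<And>n. ?Q (map d [0..<n])"
      using koenig[of "set (delta M)" ?Q] by blast
    let ?s = "\<lambda>n. cfg (run I (start I) (map d [0..<n]))"
    have "step M (?s n) (act (d n)) (?s (Suc n))" for n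
      using step_fire[OF wfs_run[OF wfs_start] d(1)[of n]] d(2)[of "Suc n"]
      by (simp add: run_append ok_append)
    moreover have "map (\<lambda>n. act (d n)) [0..<Suc n] \<in> Pref (Lq M (map lang As))" for n
      using ok_in_Pref_Lq[OF d(2)[of "Suc n"]] d(1) by (auto simp: comp_def)
    moreover have "?s 0 = init_config M" using cfg_start by simp
    ultimately have "\<exists>s \<beta>. s 0 = init_config M \<and> (\<forall>i. step M (s i) (\<beta> i) (s (Suc i)))
        \<and> (\<forall>i. map \<beta> [0..<Suc i] \<in> Pref (Lq M (map lang As)))"
      by (intro exI[of _ ?s] exI[of _ "\<lambda>n. act (d n)"] conjI allI)
    then show False using fin unfolding OB_terminating_def prod.case by blast
  qed
next
  assume dead: "dead I n"
  show "OB_terminating I"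
  proof (rule ccontr)
    assume "\<not> OB_terminating I"
    then obtain s \<beta> where s: "s 0 = init_config M" "\<And>i. step M (s i) (\<beta> i) (s (Suc i))"
      "\<And>i. map \<beta> [0..<Suc i] \<in> Pref (Lq M (map lang As))"
      unfolding OB_terminating_def by auto
    have "steps M (s i) (map \<beta> [i..<i + k]) (s (i + k))" for i k
    proof (induction k arbitrary: i)
      case (Suc k)
      have "steps M (s (Suc i)) (map \<beta> [Suc i..<i + Suc k]) (s (i + Suc k))" using Suc[of "Suc i"] by simp
      then show ?case using s(2)[of i] by (simp add: upt_rec[of i] steps_cons del: upt_Suc)
    qed (simp add: steps_nil)
    from this[of 0 n] have "steps M (init_config M) (map \<beta> [0..<n]) (s n)" by (simp add: s(1))
    moreover have "map \<beta> [0..<n] \<in> Pref (Lq M (map lang As))"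
      using s(3)[of n] by (rule Pref_prefix) (rule prefix_map_upt, simp)
    ultimately obtain \<pi> where "set \<pi> \<subseteq> set (delta M)" "map act \<pi> = map \<beta> [0..<n]" "ok I (start I) \<pi>"
      by (rule run_of_steps)
    moreover then have "length \<pi> = n" by (metis length_map length_upt minus_nat.diff_0)
    ultimately show False using dead unfolding dead_def set_paths by auto
  qed
qed

lemma Reach_eq: "Reach M (Pref (Lq M (map lang As))) =
  {cfg (run I (start I) \<pi>) | \<pi>. set \<pi> \<subseteq> set (delta M) \<and> ok I (start I) \<pi>}"
proof (intro set_eqI iffI)
  fix t assume "t \<in> Reach M (Pref (Lq M (map lang As)))"
  then obtain \<sigma> where "\<sigma> \<in> Pref (Lq M (map lang As))" "steps M (init_config M) \<sigma> t"
    unfolding Reach_def by blast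
  then show "t \<in> {cfg (run I (start I) \<pi>) | \<pi>. set \<pi> \<subseteq> set (delta M) \<and> ok I (start I) \<pi>}"
    using run_of_steps by blast
next
  fix t assume "t \<in> {cfg (run I (start I) \<pi>) | \<pi>. set \<pi> \<subseteq> set (delta M) \<and> ok I (start I) \<pi>}"
  then obtain \<pi> where \<pi>: "t = cfg (run I (start I) \<pi>)" "set \<pi> \<subseteq> set (delta M)" "ok I (start I) \<pi>" by blast
  then show "t \<in> Reach M (Pref (Lq M (map lang As)))"
    using steps_run[OF wfs_start \<pi>(2,3)] ok_in_Pref_Lq[OF \<pi>(3,2)] unfolding Reach_def cfg_start by blast
qed

lemma unbounded_iff:
  assumes "settled I n"
  shows "OB_unbounded I \<longleftrightarrow> growing I n"
proof
  assume "OB_unbounded I"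
  then have inf: "infinite {cfg (run I (start I) \<pi>) | \<pi>. set \<pi> \<subseteq> set (delta M) \<and> ok I (start I) \<pi>}"
    by (simp add: OB_unbounded_def Reach_eq)
  let ?short = "{\<pi>. set \<pi> \<subseteq> set (delta M) \<and> length \<pi> \<le> n}"
  \<comment> \<open>Finitely many runs have length at most \<open>n\<close>, so some reachable
    configuration is reached only by longer ones.\<close>
  have "finite ((\<lambda>\<pi>. cfg (run I (start I) \<pi>)) ` ?short)"
    by (intro finite_imageI finite_lists_length_le) simp
  then obtain \<pi>0 where \<pi>0: "set \<pi>0 \<subseteq> set (delta M)" "ok I (start I) \<pi>0"
    "cfg (run I (start I) \<pi>0) \<notin> (\<lambda>\<pi>. cfg (run I (start I) \<pi>)) ` ?short"
    using inf finite_subset by (smt (verit) mem_Collect_eq subsetI)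
  \<comment> \<open>Minimality refers to the product state and not to the configuration: cutting out
    a loop is sound only if the automaton states agree as well.\<close>
  let ?R = "\<lambda>\<pi>. set \<pi> \<subseteq> set (delta M) \<and> ok I (start I) \<pi> \<and> run I (start I) \<pi> = run I (start I) \<pi>0"
  obtain \<pi> where \<pi>: "?R \<pi>" and least: "\<And>\<pi>'. ?R \<pi>' \<Longrightarrow> length \<pi> \<le> length \<pi>'"
    using ex_has_least_nat[of ?R \<pi>0 length] \<pi>0 by blast
  have "cfg (run I (start I) \<pi>) \<notin> (\<lambda>\<pi>. cfg (run I (start I) \<pi>)) ` ?short"
    using \<pi> \<pi>0(3) by simp
  then have "\<pi> \<notin> ?short" by blast
  then have long: "n < length \<pi>" using \<pi> by simp
  have simple: "run I (start I) (take i \<pi>) \<noteq> run I (start I) (take j \<pi>)" if "i < j" "j \<le> length \<pi>" for i j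
  proof
    assume eq: "run I (start I) (take i \<pi>) = run I (start I) (take j \<pi>)"
    let ?\<pi>' = "take i \<pi> @ drop j \<pi>"
    have "ok I (start I) (take i \<pi> @ drop i \<pi>)" "ok I (start I) (take j \<pi> @ drop j \<pi>)" using \<pi> by simp_all
    then have "ok I (start I) ?\<pi>'" unfolding ok_append eq by simp
    moreover have "run I (start I) ?\<pi>' = run I (start I) (take j \<pi> @ drop j \<pi>)"
      unfolding run_append eq by simp
    moreover have "set ?\<pi>' \<subseteq> set (delta M)"
      using \<pi> set_take_subset[of i \<pi>] set_drop_subset[of j \<pi>] by auto
    ultimately have "?R ?\<pi>'" using \<pi> by simp
    from least[OF this] that show False by simp
  qed
  let ?u = "take n \<pi>"
  have "?u \<in> set (paths I n)" using \<pi> long set_take_subset[of n \<pi>] by (auto simp: set_paths)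
  moreover have ok: "ok I (start I) ?u"
    using \<pi> by (simp add: ok_take)
  ultimately obtain i j where "j < Suc n" "i < j" "pump I ?u i j"
    using assms unfolding settled_def by blast
  moreover then have "run I (start I) (take i ?u) \<noteq> run I (start I) (take j ?u)"
    using simple[of i j] long by (simp add: min_def)
  ultimately show "growing I n"
    unfolding growing_def using ok \<open>?u \<in> set (paths I n)\<close> by blast
next
  assume "growing I n"
  then obtain \<pi> i j where \<pi>: "set \<pi> \<subseteq> set (delta M)" "ok I (start I) \<pi>" and ij: "i < j" "pump I \<pi> i j"
    and neq: "run I (start I) (take i \<pi>) \<noteq> run I (start I) (take j \<pi>)"
    unfolding growing_def set_paths by auto
  let ?\<rho> = "drop i (take j \<pi>)"
  obtain t where okk: "\<And>k. ok I (start I) (take i \<pi> @ list_power ?\<rho> k)"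
    and content: "\<And>k c. c < nch M \<Longrightarrow> content (run I (start I) (take i \<pi> @ list_power ?\<rho> k)) c
       = content (run I (start I) (take i \<pi>)) c @ list_power (t c) k"
    and t: "\<And>c. c < nch M \<Longrightarrow> content (run I (start I) (take j \<pi>)) c = content (run I (start I) (take i \<pi>)) c @ t c"
    using pump_iterate[OF \<pi>(2,1) ij] by blast
  \<comment> \<open>The ends of a pump agree in all components but the contents, so with every
    \<open>t c\<close> empty they would be equal.\<close>
  have "\<exists>c<nch M. t c \<noteq> []"
  proof (rule ccontr)
    assume "\<not> (\<exists>c<nch M. t c \<noteq> [])"
    then have "content (run I (start I) (take j \<pi>)) c = content (run I (start I) (take i \<pi>)) c" if "c < nch M" for c
      using t that by simp
    then have "fst (snd (run I (start I) (take j \<pi>))) = fst (snd (run I (start I) (take i \<pi>)))"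
      using wfs_run[OF wfs_start] by (intro nth_equalityI) (auto simp: content_eq wfs_def)
    then show False using neq ij(2) unfolding pump_def by (simp add: prod_eq_iff)
  qed
  then obtain c where c: "c < nch M" "t c \<noteq> []" by blast
  let ?f = "\<lambda>k. cfg (run I (start I) (take i \<pi> @ list_power ?\<rho> k))"
  have "inj ?f"
  proof (rule injI)
    fix k l assume "?f k = ?f l"
    then have "content (run I (start I) (take i \<pi> @ list_power ?\<rho> k)) c = content (run I (start I) (take i \<pi> @ list_power ?\<rho> l)) c"
      by (simp add: cfg_def content_def)
    then have "length (list_power (t c) k) = length (list_power (t c) l)" using content c(1) by simp
    then show "k = l" using c(2) by (simp add: length_list_power)
  qed
  then have "infinite (range ?f)" by (rule range_inj_infinite)
  moreover have "set (take i \<pi> @ list_power ?\<rho> k) \<subseteq> set (delta M)" for k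
    using set_take_append_list_power \<pi>(1) by (rule order.trans)
  then have "range ?f \<subseteq> Reach M (Pref (Lq M (map lang As)))"
    unfolding Reach_eq using okk by blast
  ultimately show "OB_unbounded I"
    unfolding OB_unbounded_def using finite_subset by auto
qed

end

text \<open>\<open>D\<close> is evaluated only at the \<open>n\<close> found by the search, where it
  is known to be correct. On invalid instances the search may diverge, which
  \<open>decidable_on\<close> permits.\<close>

lemma decidable_on_of_search:
  assumes D: "computable (prod_enc e nat_enc) bool_enc (\<lambda>p. D (fst p) (snd p))"
    and S: "computable (prod_enc e nat_enc) bool_enc (\<lambda>p. S (fst p) (snd p))"
    and ex: "\<And>x. valid x \<Longrightarrow> \<exists>n. S x n"
    and P: "\<And>x n. valid x \<Longrightarrow> S x n \<Longrightarrow> P x \<longleftrightarrow> D x n"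
  shows "decidable_on e valid P"
proof -
  have "computable (prod_enc nat_enc e) (prod_enc e nat_enc) (\<lambda>p. (snd p, fst p))"
    by (rule computable_intros)+
  from computable_comp[OF S this]
  have "computable (prod_enc nat_enc e) bool_enc (\<lambda>p. S (snd p) (fst p))" by simp
  from computable_minimization[OF this] obtain F
    where F: "\<And>x. \<exists>n. S x n \<Longrightarrow> eval_recf F [e x] (LEAST n. S x n)" by blast
  obtain H where H: "\<And>a b. eval_recf H [a, b] (prod_encode (a, b))"
    using computable2_prod_encode unfolding computable2_def by blast
  obtain G where G: "\<And>p. eval_recf G [prod_enc e nat_enc p] (bool_enc (D (fst p) (snd p)))"
    using D unfolding computable_def by blast
  have "eval_recf (RComp G [RComp H [RProj 0, F]]) [e x] (if P x then 1 else 0)" if x: "valid x" for x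
  proof -
    let ?n = "LEAST n. S x n"
    have "eval_recf (RComp G [RComp H [RProj 0, F]]) [e x] (bool_enc (D x ?n))"
      using ev_comp1[OF ev_comp2[OF ev_proj0 F[OF ex[OF x]] H]] G[of "(x, ?n)"] by (simp add: prod_enc_def)
    moreover have "P x \<longleftrightarrow> D x ?n" by (rule P[OF x LeastI_ex[OF ex[OF x]]])
    ultimately show ?thesis by (simp add: bool_enc_def)
  qed
  then show ?thesis unfolding decidable_on_def by blast
qed

theorem theorem6p4:
  shows "decidable_on enc_instance valid_instance OB_unbounded
       \<and> decidable_on enc_instance valid_instance OB_terminating"
  unfolding enc_instance_eq
proof
  have inst: "ob_instance (fst x) (snd x)" if "valid_instance x" for x
    using that by (simp add: ob_instance_def)
  have ex: "\<exists>n. settled x n" if "valid_instance x" for x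
    using ob_instance.ex_settled[OF inst[OF that]] by simp
  show "decidable_on inst_enc valid_instance OB_unbounded"
    using ob_instance.unbounded_iff[OF inst]
    by (intro decidable_on_of_search[OF computable_growing computable_settled ex]) simp_all
  show "decidable_on inst_enc valid_instance OB_terminating"
    using ob_instance.terminating_iff[OF inst]
    by (intro decidable_on_of_search[OF computable_dead computable_settled ex]) simp_all
qed

end
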